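(* Let $(\mathscr{M};\mathcal{H})$, $(\mathscr{N};\mathcal{K})$ be represented von Neumann algebras and $\Phi:\mathscr{M}\to\mathscr{N}$ be a unital normal $*$-homomorphism. Let $\Phi_{\mathrm{aff}}:\mathscr{M}_{\mathrm{aff}}\to\mathscr{N}_{\mathrm{aff}}$ be the extension of $\Phi$ given by $\Phi_{\mathrm{aff}}(A/B)=\Phi(A)/\Phi(B)$. Let $T_1,T_2$ be closed operators affiliated with $\mathscr{M}$ (i.e. closed operators in $\mathscr{M}_{\mathrm{aff}}$). (i) If $T_1+T_2$ is pre-closed, then $\Phi_{\mathrm{aff}}(T_1)+\Phi_{\mathrm{aff}}(T_2)$ is pre-closed, and $\Phi_{\mathrm{aff}}(T_1\,\hat{+}\,T_2)=\Phi_{\mathrm{aff}}(T_1)\,\hat{+}\,\Phi_{\mathrm{aff}}(T_2)$. (ii) If $T_1T_2$ is pre-closed, then $\Phi_{\mathrm{aff}}(T_1)\Phi_{\mathrm{aff}}(T_2)$ is pre-closed, and $\Phi_{\mathrm{aff}}(T_1\,\hat{\cdot}\,T_2)=\Phi_{\mathrm{aff}}(T_1)\,\hat{\cdot}\,\Phi_{\mathrm{aff}}(T_2)$.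
   Context: A represented von Neumann algebra $(\mathscr{M};\mathcal{H})$ is a von Neumann algebra $\mathscr{M}$ acting on a complex Hilbert space $\mathcal{H}$. An unbounded operator on $\mathcal{H}$ is a linear map $T:\mathrm{dom}(T)\to\mathcal{H}$ with $\mathrm{dom}(T)$ a (not necessarily dense) linear subspace of $\mathcal{H}$, and $T$ not necessarily bounded; equality of operators includes equality of domains. $T$ is closed if its graph is closed, and pre-closed if the closure of its graph is the graph of an operator, denoted $\overline{T}$. For $A,B\in\mathcal{B}(\mathcal{H})$ with $\mathrm{null}(B)\subseteq\mathrm{null}(A)$, the quotient $A/B$ is the unbounded operator with domain $\mathrm{ran}(B)$ given by $Bx\mapsto Ax$ ($x\in\mathcal{H}$). $\mathscr{M}_{\mathrm{aff}} := \{A/B : A,B\in\mathscr{M},\ \mathrm{null}(B)\subseteq\mathrm{null}(A)\}$; it is closed under sums, products, and closures of pre-closed members. The map $\Phi_{\mathrm{aff}}$, $A/B\mapsto\Phi(A)/\Phi(B)$, makes sense and does not depend on the choice of quotient representation. Sums and products: $\mathrm{dom}(S+T)=\mathrm{dom}(S)\cap\mathrm{dom}(T)$; $\mathrm{dom}(ST)=\{x\in\mathrm{dom}(T): Tx\in\mathrm{dom}(S)\}$. For closed $S,T$, if $S+T$ (resp. $ST$) is pre-closed then the strong-sum $S\,\hat{+}\,T$ (resp. strong-product $S\,\hat{\cdot}\,T$) is $\overline{S+T}$ (resp. $\overline{ST}$). *)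

theory Defs
  imports "HOL-Analysis.Analysis"
begin

section \<open>Complex Hilbert spaces\<close>

text \<open>
  The inner product is linear in its first argument. Definiteness need not be postulated:
  it follows from the norm equation, since \<^const>\<open>norm\<close> is already a norm.
\<close>

class chilbert_space = banach +
  fixes scaleC :: "complex \<Rightarrow> 'a \<Rightarrow> 'a" (infixr "*\<^sub>C" 75)
    and cinner :: "'a \<Rightarrow> 'a \<Rightarrow> complex"
  assumes scaleC_of_real: "complex_of_real r *\<^sub>C x = r *\<^sub>R x"
    and scaleC_add_right: "c *\<^sub>C (x + y) = c *\<^sub>C x + c *\<^sub>C y"
    and scaleC_add_left: "(c + d) *\<^sub>C x = c *\<^sub>C x + d *\<^sub>C x"
    and scaleC_scaleC: "c *\<^sub>C d *\<^sub>C x = (c * d) *\<^sub>C x"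
    and cinner_commute: "cinner x y = cnj (cinner y x)"
    and cinner_add_left: "cinner (x + y) z = cinner x z + cinner y z"
    and cinner_scaleC_left: "cinner (c *\<^sub>C x) y = c * cinner x y"
    and norm_eq_sqrt_cinner: "norm x = sqrt (Re (cinner x x))"

instantiation complex :: chilbert_space
begin
definition scaleC_complex :: "complex \<Rightarrow> complex \<Rightarrow> complex"
  where "scaleC_complex c x = c * x"
definition cinner_complex :: "complex \<Rightarrow> complex \<Rightarrow> complex"
  where "cinner_complex x y = x * cnj y"
instance
  by standard (auto simp: scaleC_complex_def cinner_complex_def algebra_simps
      scaleR_conv_of_real cmod_def power2_eq_square)
end

lemma norm_scaleC: "norm (c *\<^sub>C x) = cmod c * norm (x :: 'a::chilbert_space)"
proof -
  have "cinner (c *\<^sub>C x) (c *\<^sub>C x) = c * cnj c * cinner x x"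
    by (metis cinner_commute cinner_scaleC_left complex_cnj_mult mult.assoc mult.commute)
  also have "c * cnj c = complex_of_real ((cmod c)\<^sup>2)"
    by (rule complex_norm_square[symmetric])
  finally have "Re (cinner (c *\<^sub>C x) (c *\<^sub>C x)) = (cmod c)\<^sup>2 * Re (cinner x x)"
    by (simp only: Re_complex_of_real times_complex.sel Im_complex_of_real mult_zero_left diff_zero)
  then show ?thesis
    unfolding norm_eq_sqrt_cinner[of "c *\<^sub>C x"] norm_eq_sqrt_cinner[of x]
    by (simp only: real_sqrt_mult real_sqrt_abs abs_norm_cancel)
qed

lemma bounded_linear_scaleC: "bounded_linear (\<lambda>x :: 'a::chilbert_space. c *\<^sub>C x)"
proof (rule bounded_linear_intro)
  show "c *\<^sub>C (r *\<^sub>R x) = r *\<^sub>R (c *\<^sub>C x)" for r and x :: 'a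
    by (metis mult.commute scaleC_of_real scaleC_scaleC)
  show "norm (c *\<^sub>C x) \<le> norm x * cmod c" for x :: 'a
    by (simp add: norm_scaleC)
qed (rule scaleC_add_right)


section \<open>Bounded operators and von Neumann algebras\<close>

text \<open>
  The library type of bounded \<^emph>\<open>real\<close>-linear maps is used as the ambient type;
  \<open>bounded_ops\<close> is \<open>\<B>(\<H>)\<close>.
\<close>

definition bounded_ops :: "('a::chilbert_space \<Rightarrow>\<^sub>L 'a) set"
  where "bounded_ops = {A :: 'a \<Rightarrow>\<^sub>L 'a. \<forall>c x. A (c *\<^sub>C x) = c *\<^sub>C A x}"

lift_definition op_scaleC ::
    "complex \<Rightarrow> ('a::chilbert_space \<Rightarrow>\<^sub>L 'a) \<Rightarrow> ('a \<Rightarrow>\<^sub>L 'a)"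
  is "\<lambda>c A x. c *\<^sub>C A x"
  by (rule bounded_linear_compose[OF bounded_linear_scaleC])

definition op_adj :: "('a::chilbert_space \<Rightarrow>\<^sub>L 'a) \<Rightarrow> ('a \<Rightarrow>\<^sub>L 'a)"
  where "op_adj A = (THE B :: 'a \<Rightarrow>\<^sub>L 'a. \<forall>x y. cinner (A x) y = cinner x (B y))"

definition commutant :: "('a::chilbert_space \<Rightarrow>\<^sub>L 'a) set \<Rightarrow> ('a \<Rightarrow>\<^sub>L 'a) set"
  where "commutant S = {A \<in> bounded_ops. \<forall>B\<in>S. A o\<^sub>L B = B o\<^sub>L A}"

definition von_neumann_algebra :: "('a::chilbert_space \<Rightarrow>\<^sub>L 'a) set \<Rightarrow> bool"
  where "von_neumann_algebra M \<longleftrightarrow>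
    M \<subseteq> bounded_ops \<and> (\<forall>A\<in>M. op_adj A \<in> M) \<and> commutant (commutant M) = M"

definition self_adjoint_part :: "('a::chilbert_space \<Rightarrow>\<^sub>L 'a) set \<Rightarrow> ('a \<Rightarrow>\<^sub>L 'a) set"
  where "self_adjoint_part M = {A \<in> M. op_adj A = A}"

definition op_le :: "('a::chilbert_space \<Rightarrow>\<^sub>L 'a) \<Rightarrow> ('a \<Rightarrow>\<^sub>L 'a) \<Rightarrow> bool"
  where "op_le A B \<longleftrightarrow> (\<forall>x. cinner ((B - A) x) x \<in> \<real>\<^sub>\<ge>\<^sub>0)"

definition is_sup_in ::
    "('a::chilbert_space \<Rightarrow>\<^sub>L 'a) set \<Rightarrow> ('a \<Rightarrow>\<^sub>L 'a) set \<Rightarrow> ('a \<Rightarrow>\<^sub>L 'a) \<Rightarrow> bool"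
  where "is_sup_in M D S \<longleftrightarrow> S \<in> self_adjoint_part M \<and> (\<forall>A\<in>D. op_le A S) \<and>
    (\<forall>S'\<in>self_adjoint_part M. (\<forall>A\<in>D. op_le A S') \<longrightarrow> op_le S S')"

definition unital_star_hom ::
    "('a::chilbert_space \<Rightarrow>\<^sub>L 'a) set \<Rightarrow> ('b::chilbert_space \<Rightarrow>\<^sub>L 'b) set
      \<Rightarrow> (('a \<Rightarrow>\<^sub>L 'a) \<Rightarrow> ('b \<Rightarrow>\<^sub>L 'b)) \<Rightarrow> bool"
  where "unital_star_hom M N \<Phi> \<longleftrightarrow>
    (\<forall>A\<in>M. \<Phi> A \<in> N) \<and>
    (\<forall>A\<in>M. \<forall>B\<in>M. \<Phi> (A + B) = \<Phi> A + \<Phi> B) \<and>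
    (\<forall>c. \<forall>A\<in>M. \<Phi> (op_scaleC c A) = op_scaleC c (\<Phi> A)) \<and>
    (\<forall>A\<in>M. \<forall>B\<in>M. \<Phi> (A o\<^sub>L B) = \<Phi> A o\<^sub>L \<Phi> B) \<and>
    (\<forall>A\<in>M. \<Phi> (op_adj A) = op_adj (\<Phi> A)) \<and>
    \<Phi> id_blinfun = id_blinfun"

text \<open>
  Normality: suprema of bounded increasing nets of self-adjoint elements are preserved. Such
  nets are represented by their ranges, the upward directed sets.
\<close>

definition normal_map ::
    "('a::chilbert_space \<Rightarrow>\<^sub>L 'a) set \<Rightarrow> ('b::chilbert_space \<Rightarrow>\<^sub>L 'b) set
      \<Rightarrow> (('a \<Rightarrow>\<^sub>L 'a) \<Rightarrow> ('b \<Rightarrow>\<^sub>L 'b)) \<Rightarrow> bool"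
  where "normal_map M N \<Phi> \<longleftrightarrow>
    (\<forall>D S. D \<noteq> {} \<and> D \<subseteq> self_adjoint_part M \<and>
       (\<forall>A\<in>D. \<forall>B\<in>D. \<exists>C\<in>D. op_le A C \<and> op_le B C) \<and> is_sup_in M D S
       \<longrightarrow> is_sup_in N (\<Phi> ` D) (\<Phi> S))"


section \<open>Unbounded operators\<close>

text \<open>
  An unbounded operator is a partial map, so that equality of operators includes equality of
  domains, and the product \<open>S T\<close> is the composition \<open>S \<circ>\<^sub>m T\<close> of partial maps.
\<close>

type_synonym 'a partial_op = "'a \<Rightarrow> 'a option"

definition unbounded_op :: "'a::chilbert_space partial_op \<Rightarrow> bool"
  where "unbounded_op T \<longleftrightarrow>
    0 \<in> dom T \<and>
    (\<forall>x\<in>dom T. \<forall>y\<in>dom T. x + y \<in> dom T \<and> the (T (x + y)) = the (T x) + the (T y)) \<and>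
    (\<forall>c. \<forall>x\<in>dom T. c *\<^sub>C x \<in> dom T \<and> the (T (c *\<^sub>C x)) = c *\<^sub>C the (T x))"

definition closed_op :: "'a::chilbert_space partial_op \<Rightarrow> bool"
  where "closed_op T \<longleftrightarrow> unbounded_op T \<and> closed (Map.graph T)"

definition preclosed_op :: "'a::chilbert_space partial_op \<Rightarrow> bool"
  where "preclosed_op T \<longleftrightarrow> unbounded_op T \<and>
    (\<exists>S. unbounded_op S \<and> Map.graph S = closure (Map.graph T))"

text \<open>Meaningful for pre-closed operators only.\<close>

definition op_closure :: "'a::chilbert_space partial_op \<Rightarrow> 'a partial_op"
  where "op_closure T = (THE S. Map.graph S = closure (Map.graph T))"

definition op_sum :: "'a::chilbert_space partial_op \<Rightarrow> 'a partial_op \<Rightarrow> 'a partial_op"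
  where "op_sum S T =
    (\<lambda>x. if x \<in> dom S \<inter> dom T then Some (the (S x) + the (T x)) else None)"

text \<open>
  Strong sums and products are left unspecified unless both operands are closed and their sum,
  respectively product, is pre-closed.
\<close>

definition strong_sum :: "'a::chilbert_space partial_op \<Rightarrow> 'a partial_op \<Rightarrow> 'a partial_op"
  where "strong_sum S T =
    (if closed_op S \<and> closed_op T \<and> preclosed_op (op_sum S T)
     then op_closure (op_sum S T) else undefined)"

definition strong_prod :: "'a::chilbert_space partial_op \<Rightarrow> 'a partial_op \<Rightarrow> 'a partial_op"
  where "strong_prod S T =
    (if closed_op S \<and> closed_op T \<and> preclosed_op (S \<circ>\<^sub>m T)
     then op_closure (S \<circ>\<^sub>m T) else undefined)"


section \<open>Quotients and the affiliated extension\<close>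

definition null_space :: "('a::chilbert_space \<Rightarrow>\<^sub>L 'a) \<Rightarrow> 'a set"
  where "null_space A = {x. A x = 0}"

text \<open>
  The quotient \<open>A / B\<close>. The description below is unique on the range of \<open>B\<close> exactly when
  \<open>null_space B \<subseteq> null_space A\<close>.
\<close>

definition quot :: "('a::chilbert_space \<Rightarrow>\<^sub>L 'a) \<Rightarrow> ('a \<Rightarrow>\<^sub>L 'a) \<Rightarrow> 'a partial_op"
  where "quot A B =
    (\<lambda>y. if y \<in> range (blinfun_apply B) then Some (THE z. \<exists>x. y = B x \<and> z = A x) else None)"

definition affiliated :: "('a::chilbert_space \<Rightarrow>\<^sub>L 'a) set \<Rightarrow> 'a partial_op set"
  where "affiliated M = {quot A B | A B. A \<in> M \<and> B \<in> M \<and> null_space B \<subseteq> null_space A}"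

text \<open>
  \<open>\<Phi>\<^sub>a\<^sub>f\<^sub>f\<close>; the description is unique because \<open>\<Phi> A / \<Phi> B\<close> depends on \<open>A / B\<close> only.
\<close>

definition aff_ext ::
    "('a::chilbert_space \<Rightarrow>\<^sub>L 'a) set \<Rightarrow> (('a \<Rightarrow>\<^sub>L 'a) \<Rightarrow> ('b::chilbert_space \<Rightarrow>\<^sub>L 'b))
      \<Rightarrow> 'a partial_op \<Rightarrow> 'b partial_op"
  where "aff_ext M \<Phi> T =
    (THE S. \<exists>A B. A \<in> M \<and> B \<in> M \<and> null_space B \<subseteq> null_space A \<and>
       T = quot A B \<and> S = quot (\<Phi> A) (\<Phi> B))"

end

theory Submission
  imports Defs
begin

text \<open>
  The graph of \<open>A / B\<close> is the range of the operator matrix with first column \<open>(B, A)\<close> and second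
  column \<open>0\<close>, so affiliated operators are studied through ranges of elements \<open>V\<close> of the algebra
  of two-by-two matrices over \<open>M\<close>, on which \<open>\<Phi>\<close> acts entrywise.

  By Douglas factorisation and the Baire category theorem, an inclusion of such ranges means
  \<open>V = W X\<close> with \<open>X\<close> in the algebra, hence is preserved by \<open>\<Phi>\<close>. The projection onto the null space of
  \<open>B\<close> is the limit of the decreasing sequence of even powers of \<open>1 - B\<^sup>*B / c\<close>, so normality makes
  \<open>\<Phi>\<close> preserve null projections. Sums and products have graphs \<open>ran (U P)\<close> with \<open>P\<close> a null projection,
  and the closure of \<open>ran V\<close> is the range of \<open>1 - P\<close> with \<open>P\<close> the null projection of \<open>V\<^sup>*\<close>. A range
  of a projection that is the graph of an operator is again the graph of a quotient, by a square
  root of its upper left entry.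
\<close>

section \<open>Complex inner products and adjoints\<close>

text \<open>Pre-closedness of the image is the delicate point, because a homomorphism sees algebraic
  identities and not closures of graphs. For a projection \<open>E\<close> with lower right entry
  \<open>e22\<close>, a vertical vector \<open>(0, y)\<close> lies in the range of \<open>E\<close>
  exactly when \<open>e22 y = y\<close>, so the range is a graph exactly when \<open>1 - e22\<close>
  is injective. That is an inclusion of null spaces, hence an identity \<open>A P = 0\<close> with
  \<open>P\<close> a null projection, and such identities survive \<Phi>. Without normality an
  injective operator may have an image that is not injective. Normality is given for \<Phi> on
  \<open>M\<close> alone, so matrices have to be reached through scalar compressions. The closure
  must also be exhibited as a quotient again, since the extension of \<Phi> is evaluated on
  quotients.\<close>

lemma cinner_add_right: "cinner x (y + z) = cinner x y + cinner x (z :: 'a::chilbert_space)"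
  by (metis cinner_commute cinner_add_left complex_cnj_add)

lemma cinner_scaleC_right: "cinner x (c *\<^sub>C y) = cnj c * cinner x (y :: 'a::chilbert_space)"
  by (metis cinner_commute cinner_scaleC_left complex_cnj_mult)

lemma cinner_scaleR_left: "cinner (r *\<^sub>R x) y = of_real r * cinner x (y :: 'a::chilbert_space)"
  by (simp flip: scaleC_of_real add: cinner_scaleC_left)

lemma cinner_scaleR_right: "cinner x (r *\<^sub>R y) = of_real r * cinner x (y :: 'a::chilbert_space)"
  by (simp flip: scaleC_of_real add: cinner_scaleC_right)

lemma cinner_minus_left: "cinner (- x) y = - cinner x (y :: 'a::chilbert_space)"
  using cinner_scaleR_left[of "-1" x y] by simp

lemma cinner_minus_right: "cinner x (- y) = - cinner x (y :: 'a::chilbert_space)"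
  using cinner_scaleR_right[of x "-1" y] by simp

lemma cinner_diff_left: "cinner (x - y) z = cinner x z - cinner y (z :: 'a::chilbert_space)"
  using cinner_add_left[of x "- y" z] by (simp add: cinner_minus_left)

lemma cinner_diff_right: "cinner x (y - z) = cinner x y - cinner x (z :: 'a::chilbert_space)"
  using cinner_add_right[of x y "- z"] by (simp add: cinner_minus_right)

lemma cinner_zero_left [simp]: "cinner 0 (y :: 'a::chilbert_space) = 0"
  using cinner_scaleR_left[of 0 0 y] by simp

lemma cinner_zero_right [simp]: "cinner (y :: 'a::chilbert_space) 0 = 0"
  using cinner_scaleR_right[of y 0 0] by simp

lemmas cinner_simps = cinner_add_left cinner_add_right cinner_diff_left cinner_diff_right
  cinner_scaleR_left cinner_scaleR_right cinner_scaleC_left cinner_scaleC_right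
  cinner_minus_left cinner_minus_right

lemma Re_cinner_commute: "Re (cinner x y) = Re (cinner y (x :: 'a::chilbert_space))"
  by (subst cinner_commute) simp

lemma cinner_self: "cinner x x = of_real ((norm (x :: 'a::chilbert_space))\<^sup>2)"
proof -
  have "Im (cinner x x) = 0"
    using arg_cong[OF cinner_commute[of x x], of Im] by simp
  moreover have "Re (cinner x x) \<ge> 0"
    using norm_ge_zero[of x] unfolding norm_eq_sqrt_cinner real_sqrt_ge_0_iff .
  then have "Re (cinner x x) = (norm x)\<^sup>2"
    by (simp add: norm_eq_sqrt_cinner)
  ultimately show ?thesis by (simp add: complex_eq_iff)
qed

lemma cinner_ext:
  assumes "\<And>z. cinner z x = cinner z (y :: 'a::chilbert_space)"
  shows "x = y"
proof -
  have "cinner (x - y) (x - y) = 0"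
    by (simp add: cinner_diff_right assms)
  then show ?thesis by (simp add: cinner_self)
qed

lemma cinner_ext_left:
  assumes "\<And>z. cinner x z = cinner (y :: 'a::chilbert_space) z"
  shows "x = y"
  by (rule cinner_ext) (metis assms cinner_commute)

lemma norm_add_sq:
  "(norm (x + y))\<^sup>2 = (norm x)\<^sup>2 + 2 * Re (cinner x y) + (norm (y :: 'a::chilbert_space))\<^sup>2"
proof -
  have "(norm (x + y))\<^sup>2 = Re (cinner (x + y) (x + y))" by (simp add: cinner_self)
  also have "\<dots> = (norm x)\<^sup>2 + 2 * Re (cinner x y) + (norm y)\<^sup>2"
    unfolding cinner_add_left cinner_add_right by (simp add: cinner_self Re_cinner_commute[of y x])
  finally show ?thesis .
qed

lemma norm_diff_sq:
  "(norm (x - y))\<^sup>2 = (norm x)\<^sup>2 - 2 * Re (cinner x y) + (norm (y :: 'a::chilbert_space))\<^sup>2"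
  using norm_add_sq[of x "- y"] by (simp add: cinner_minus_right)

lemma Re_cinner_le: "Re (cinner x y) \<le> norm x * norm (y :: 'a::chilbert_space)"
proof (cases "x = 0 \<or> y = 0")
  case True
  then show ?thesis by auto
next
  case False
  have "0 \<le> (norm (norm y *\<^sub>R x - norm x *\<^sub>R y))\<^sup>2" by simp
  also have "\<dots> = 2 * (norm x * norm y) * (norm x * norm y - Re (cinner x y))"
    unfolding norm_diff_sq
    by (simp add: cinner_scaleR_left cinner_scaleR_right algebra_simps power2_eq_square)
  finally have "0 \<le> norm x * norm y * (norm x * norm y - Re (cinner x y))" by simp
  moreover have "0 < norm x * norm y" using False by simp
  ultimately have "0 \<le> norm x * norm y - Re (cinner x y)" by (simp only: zero_le_mult_iff) linarith
  then show ?thesis by simp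
qed

lemma cmod_cinner_le: "cmod (cinner x y) \<le> norm x * norm (y :: 'a::chilbert_space)"
proof (cases "cinner x y = 0")
  case False
  \<comment> \<open>The unimodular factor that turns the inner product into its modulus, so that the
    bound on real parts applies.\<close>
  define c where "c = cnj (cinner x y) / of_real (cmod (cinner x y))"
  have c: "cmod c = 1" using False by (simp add: c_def norm_divide)
  have "cinner (c *\<^sub>C x) y = of_real (cmod (cinner x y))"
    using False complex_norm_square[of "cinner x y"]
    by (simp add: c_def cinner_scaleC_left field_simps power2_eq_square)
  then show ?thesis
    using Re_cinner_le[of "c *\<^sub>C x" y] by (simp add: norm_scaleC c)
qed simp

lemma bounded_bilinear_cinner: "bounded_bilinear (cinner :: 'a::chilbert_space \<Rightarrow> 'a \<Rightarrow> complex)"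
proof
  show "\<exists>K. \<forall>a b. norm (cinner a (b::'a)) \<le> norm a * norm b * K"
    by (rule exI[of _ 1]) (simp add: cmod_cinner_le)
qed (simp_all add: cinner_simps scaleR_conv_of_real)

lemmas tendsto_cinner = bounded_bilinear.tendsto[OF bounded_bilinear_cinner]

lemma scaleC_zero_right [simp]: "c *\<^sub>C (0 :: 'a::chilbert_space) = 0"
  by (rule linear_0[OF bounded_linear.linear[OF bounded_linear_scaleC]])

lemma tendsto_scaleC: "(f \<longlongrightarrow> l) F \<Longrightarrow> ((\<lambda>x. c *\<^sub>C f x) \<longlongrightarrow> c *\<^sub>C (l :: 'a::chilbert_space)) F"
  by (rule bounded_linear.tendsto[OF bounded_linear_scaleC])

text \<open>Expanding squared distances bounds them by sums of errors; minimising sequences and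
  power sequences are both shown to be Cauchy in this way.\<close>

lemma Cauchy_if_norm_sq_le:
  fixes x :: "nat \<Rightarrow> 'a::real_normed_vector"
  assumes le: "\<And>m n. (norm (x m - x n))\<^sup>2 \<le> c * (r m + r n)" and "c \<ge> 0" and r: "r \<longlonglongrightarrow> 0"
  shows "Cauchy x"
proof (rule metric_CauchyI)
  fix e :: real assume "e > 0"
  \<comment> \<open>The \<open>+ 1\<close> keeps the denominator positive when \<open>c = 0\<close>
    and makes the last estimate strict.\<close>
  then have "\<forall>\<^sub>F n in sequentially. r n < e\<^sup>2 / (2 * c + 1)"
    using \<open>c \<ge> 0\<close> by (intro order_tendstoD(2)[OF r]) simp
  then obtain n0 where n0: "\<And>n. n \<ge> n0 \<Longrightarrow> r n < e\<^sup>2 / (2 * c + 1)"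
    by (auto simp: eventually_sequentially)
  have "dist (x m) (x n) < e" if "m \<ge> n0" "n \<ge> n0" for m n
  proof -
    have "(norm (x m - x n))\<^sup>2 \<le> c * (r m + r n)" by (rule le)
    also have "\<dots> \<le> c * (e\<^sup>2 / (2 * c + 1) + e\<^sup>2 / (2 * c + 1))"
      using n0[OF that(1)] n0[OF that(2)] \<open>c \<ge> 0\<close> by (intro mult_left_mono) auto
    also have "\<dots> = (2 * c) * e\<^sup>2 / (2 * c + 1)" by simp
    also have "\<dots> < e\<^sup>2" using \<open>c \<ge> 0\<close> \<open>e > 0\<close> by (subst pos_divide_less_eq) (auto simp: algebra_simps)
    finally show ?thesis using \<open>e > 0\<close> by (simp add: dist_norm power_less_imp_less_base)
  qed
  then show "\<exists>M. \<forall>m\<ge>M. \<forall>n\<ge>M. dist (x m) (x n) < e" by blast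
qed

text \<open>The representing vector minimises \<open>\<lambda>x. (norm x)\<^sup>2 - 2 * Re (f x)\<close>.\<close>

lemma Riesz_representation:
  fixes f :: "'a::chilbert_space \<Rightarrow> complex"
  assumes f: "bounded_linear f" and fC: "\<And>c x. f (c *\<^sub>C x) = c * f x"
  obtains v where "\<And>x. f x = cinner x v"
proof -
  interpret f: bounded_linear f by fact
  define J where "J x = (norm x)\<^sup>2 - 2 * Re (f x)" for x
  obtain K where K: "\<And>x. norm (f x) \<le> norm x * K" using f.bounded by blast
  have "- K\<^sup>2 \<le> J x" for x
  proof -
    have "Re (f x) \<le> norm x * K" using K[of x] complex_Re_le_cmod[of "f x"] by linarith
    moreover have "0 \<le> (norm x - K)\<^sup>2" by simp
    ultimately show ?thesis by (simp add: J_def power2_diff)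
  qed
  then have bdd: "bdd_below (range J)" by (auto intro!: bdd_belowI)
  define m where "m = Inf (range J)"
  have mle: "m \<le> J x" for x unfolding m_def by (intro cInf_lower bdd) auto
  have "\<exists>x. J x < m + 1 / real (Suc n)" for n
    using cInf_lessD[of "range J" "m + 1 / real (Suc n)"] by (auto simp: m_def)
  then obtain x where x: "\<And>n. J (x n) < m + 1 / real (Suc n)" by metis
  have "(norm (x p - x q))\<^sup>2 \<le> 2 * (1 / real (Suc p) + 1 / real (Suc q))" for p q
  proof -
    \<comment> \<open>The parallelogram law: \<open>J\<close> is at least \<open>m\<close> at the
      midpoint, which forces near-minimisers to be close.\<close>
    have "(norm (x p - x q))\<^sup>2
        = 2 * J (x p) + 2 * J (x q) - 4 * J ((1/2) *\<^sub>R (x p + x q))"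
      unfolding J_def f.scaleR f.add norm_scaleR power_mult_distrib norm_diff_sq norm_add_sq
      by (simp add: power2_eq_square field_simps)
    then show ?thesis using mle[of "(1/2) *\<^sub>R (x p + x q)"] x[of p] x[of q] by simp
  qed
  then have "Cauchy x"
    using LIMSEQ_Suc[OF lim_1_over_n] by (intro Cauchy_if_norm_sq_le[of x 2]) auto
  then obtain v where v: "x \<longlonglongrightarrow> v" using Cauchy_convergent convergent_def by blast
  have "(\<lambda>n. J (x n)) \<longlonglongrightarrow> J v"
    unfolding J_def by (intro tendsto_intros f.tendsto v)
  moreover have "(\<lambda>n. m + 1 / real (Suc n)) \<longlonglongrightarrow> m + 0"
    by (intro tendsto_intros LIMSEQ_Suc[OF lim_1_over_n])
  ultimately have Jv: "J v \<le> m"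
    using LIMSEQ_le[of "\<lambda>n. J (x n)" "J v" "\<lambda>n. m + 1 / real (Suc n)" "m + 0"] x less_imp_le by auto
  have re: "Re (f h) = Re (cinner h v)" for h
  proof (rule ccontr)
    assume ne: "Re (f h) \<noteq> Re (cinner h v)"
    define d where "d = Re (f h) - Re (cinner h v)"
    have "h \<noteq> 0" using ne f.zero by auto
    \<comment> \<open>The minimiser of the quadratic
      \<open>t\<^sup>2 * (norm h)\<^sup>2 - 2 * t * d\<close> by which \<open>J\<close> changes
      along \<open>h\<close>.\<close>
    define t where "t = d / (norm h)\<^sup>2"
    have "J (v + t *\<^sub>R h) = J v + t\<^sup>2 * (norm h)\<^sup>2 - 2 * t * d"
      unfolding J_def norm_add_sq f.add f.scaleR d_def
      using Re_cinner_commute[of v h]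
      by (simp add: cinner_scaleR_right power_mult_distrib algebra_simps)
    also have "\<dots> = J v - d\<^sup>2 / (norm h)\<^sup>2"
      using \<open>h \<noteq> 0\<close> by (simp add: t_def power2_eq_square field_simps)
    also have "\<dots> < J v" using ne \<open>h \<noteq> 0\<close> by (simp add: d_def)
    also note Jv
    finally show False using mle[of "v + t *\<^sub>R h"] by simp
  qed
  \<comment> \<open>Replacing \<open>h\<close> by \<open>\<i> *\<^sub>C h\<close> turns equality of
    real parts into equality of imaginary parts.\<close>
  have "f h = cinner h v" for h
    using re[of h] re[of "\<i> *\<^sub>C h"] by (simp add: fC cinner_scaleC_left complex_eq_iff)
  then show ?thesis by (rule that)
qed

section \<open>Adjoints of complex-linear operators\<close>

lemma op_adj_unique:
  fixes A B :: "'a::chilbert_space \<Rightarrow>\<^sub>L 'a"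
  assumes "\<And>x y. cinner (A x) y = cinner x (B y)"
  shows "op_adj A = B"
  unfolding op_adj_def
proof (rule the_equality)
  show "C = B" if "\<forall>x y. cinner (A x) y = cinner x (C y)" for C :: "'a \<Rightarrow>\<^sub>L 'a"
    by (rule blinfun_eqI, rule cinner_ext) (use that assms in metis)
qed (use assms in blast)

lemma bounded_ops_scaleC: "A \<in> bounded_ops \<Longrightarrow> A (c *\<^sub>C x) = c *\<^sub>C A x"
  by (simp add: bounded_ops_def)

text \<open>The value at \<open>y\<close> is the Riesz vector of
  \<open>\<lambda>x. cinner (A x) y\<close>. Membership in \<open>bounded_ops\<close> makes this
  functional complex-linear; elements of the ambient type are only real-linear.\<close>

lemma op_adj_exists:
  fixes A :: "'a::chilbert_space \<Rightarrow>\<^sub>L 'a"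
  assumes A: "A \<in> bounded_ops"
  shows "\<exists>B :: 'a \<Rightarrow>\<^sub>L 'a. \<forall>x y. cinner (A x) y = cinner x (B y)"
proof -
  have "\<exists>v. \<forall>x. cinner (A x) y = cinner x v" for y
  proof -
    have "bounded_linear (\<lambda>x. cinner (A x) y)"
      by (intro bounded_linear_compose[OF bounded_bilinear.bounded_linear_left[OF bounded_bilinear_cinner]]
          blinfun.bounded_linear_right)
    then show ?thesis
      by (rule Riesz_representation) (auto simp: bounded_ops_scaleC[OF A] cinner_scaleC_left)
  qed
  then obtain g where g: "\<And>x y. cinner (A x) y = cinner x (g y)" by metis
  have "bounded_linear g"
  proof (rule bounded_linear_intro)
    show "g (x + y) = g x + g y" for x y
      by (rule cinner_ext) (simp add: cinner_add_right flip: g)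
    show "g (r *\<^sub>R x) = r *\<^sub>R g x" for r x
      by (rule cinner_ext) (simp add: cinner_scaleR_right flip: g)
    show "norm (g y) \<le> norm y * norm A" for y
    proof (cases "g y = 0")
      case False
      have "(norm (g y))\<^sup>2 = Re (cinner (A (g y)) y)" by (simp add: g cinner_self)
      also have "\<dots> \<le> norm (A (g y)) * norm y" by (rule Re_cinner_le)
      also have "\<dots> \<le> norm A * norm (g y) * norm y"
        by (intro mult_right_mono norm_blinfun) auto
      finally have "norm (g y) * norm (g y) \<le> norm (g y) * (norm y * norm A)"
        by (simp add: power2_eq_square algebra_simps)
      then show ?thesis using False by simp
    qed simp
  qed
  then show ?thesis by (intro exI[of _ "Blinfun g"]) (simp add: bounded_linear_Blinfun_apply g)
qed

lemma cinner_op_adj: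
  assumes "A \<in> bounded_ops"
  shows "cinner (blinfun_apply A x) y = cinner x (op_adj A y)"
  using op_adj_exists[OF assms] op_adj_unique by metis

lemma cinner_op_adj':
  assumes "A \<in> bounded_ops"
  shows "cinner x (blinfun_apply A y) = cinner (op_adj A x) y"
  by (metis assms cinner_op_adj cinner_commute)

lemma op_adj_in_bounded_ops:
  assumes "A \<in> bounded_ops" shows "op_adj A \<in> bounded_ops"
  unfolding bounded_ops_def
proof (clarify, rule cinner_ext)
  fix c x z
  show "cinner z (op_adj A (c *\<^sub>C x)) = cinner z (c *\<^sub>C op_adj A x)"
    by (simp add: cinner_op_adj[OF assms, symmetric] cinner_scaleC_right)
qed

lemma op_adj_op_adj:
  assumes "A \<in> bounded_ops" shows "op_adj (op_adj A) = A"
  by (rule op_adj_unique) (simp add: cinner_op_adj'[OF assms])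

lemma op_adj_compose:
  assumes "A \<in> bounded_ops" "B \<in> bounded_ops"
  shows "op_adj (A o\<^sub>L B) = op_adj B o\<^sub>L op_adj A"
  by (rule op_adj_unique) (simp add: cinner_op_adj assms)

lemma norm_op_adj_apply_le:
  assumes "A \<in> bounded_ops" shows "norm (op_adj A x) \<le> norm A * norm x"
proof (cases "op_adj A x = 0")
  case False
  have "(norm (op_adj A x))\<^sup>2 = Re (cinner (A (op_adj A x)) x)"
    by (simp add: cinner_op_adj[OF assms] cinner_self)
  also have "\<dots> \<le> norm (A (op_adj A x)) * norm x" by (rule Re_cinner_le)
  also have "\<dots> \<le> norm A * norm (op_adj A x) * norm x"
    by (intro mult_right_mono norm_blinfun) auto
  finally have "norm (op_adj A x) * norm (op_adj A x) \<le> norm (op_adj A x) * (norm A * norm x)"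
    by (simp add: power2_eq_square algebra_simps)
  then show ?thesis using False by simp
qed (simp add: zero_le_mult_iff)

text \<open>Polarisation: comparing the forms at \<open>x + c *\<^sub>C y\<close> with
  \<open>c = 1\<close> and \<open>c = \<i>\<close> separates the two mixed terms.\<close>

lemma blinfun_eq_if_quadratic_form_eq:
  fixes A B :: "'a::chilbert_space \<Rightarrow>\<^sub>L 'a"
  assumes A: "A \<in> bounded_ops" and B: "B \<in> bounded_ops"
    and q: "\<And>x. cinner (A x) x = cinner (B x) x"
  shows "A = B"
proof (rule blinfun_eqI, rule cinner_ext_left)
  fix x y
  have q': "cinner (A (x + c *\<^sub>C y)) (x + c *\<^sub>C y) = cinner (B (x + c *\<^sub>C y)) (x + c *\<^sub>C y)" for c
    by (rule q)
  have eq: "cnj c * cinner (A x) y + c * cinner (A y) x = cnj c * cinner (B x) y + c * cinner (B y) x" for c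
    using q'[of c] q[of x] q[of y]
    by (simp add: cinner_simps blinfun.add_right bounded_ops_scaleC[OF A] bounded_ops_scaleC[OF B] algebra_simps)
  have "cinner (A x) y + cinner (A y) x = cinner (B x) y + cinner (B y) x"
    using eq[of 1] by simp
  moreover have "\<i> * (- cinner (A x) y + cinner (A y) x) = \<i> * (- cinner (B x) y + cinner (B y) x)"
    using eq[of \<i>] by (simp add: algebra_simps)
  ultimately show "cinner (A x) y = cinner (B x) y" by (auto simp: complex_eq_iff)
qed


section \<open>Strong limits and von Neumann algebras\<close>

lemma strong_limit_exists:
  fixes X :: "nat \<Rightarrow> 'a::real_normed_vector \<Rightarrow>\<^sub>L 'b::banach"
  assumes bd: "\<And>n x. norm (X n x) \<le> c * norm x" and C: "\<And>x. Cauchy (\<lambda>n. X n x)"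
  obtains P where "\<And>x. (\<lambda>n. X n x) \<longlonglongrightarrow> blinfun_apply P x"
proof -
  have "\<exists>l. (\<lambda>n. X n x) \<longlonglongrightarrow> l" for x
    using C[of x] by (simp add: Cauchy_convergent_iff convergent_def)
  then obtain p where p: "\<And>x. (\<lambda>n. X n x) \<longlonglongrightarrow> p x" by metis
  have "bounded_linear p"
  proof (rule bounded_linear_intro)
    show "p (x + y) = p x + p y" for x y
      using tendsto_add[OF p p, of x y] p[of "x + y"] LIMSEQ_unique by (simp add: blinfun.add_right) blast
    show "p (r *\<^sub>R x) = r *\<^sub>R p x" for r x
      using tendsto_scaleR[OF tendsto_const p, of r x] p[of "r *\<^sub>R x"] LIMSEQ_unique
      by (simp add: blinfun.scaleR_right) blast
    show "norm (p x) \<le> norm x * c" for x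
      using bd by (intro LIMSEQ_le_const2[OF tendsto_norm[OF p]]) (auto simp: mult.commute)
  qed
  then show ?thesis
    by (intro that[of "Blinfun p"]) (simp add: bounded_linear_Blinfun_apply p)
qed

lemma strong_limit_unique:
  assumes "\<And>x. (\<lambda>n. X n x) \<longlonglongrightarrow> blinfun_apply P x" "\<And>x. (\<lambda>n. X n x) \<longlonglongrightarrow> blinfun_apply Q x"
  shows "P = Q"
  by (rule blinfun_eqI) (use assms LIMSEQ_unique in blast)

locale vN_algebra =
  fixes M :: "('a::chilbert_space \<Rightarrow>\<^sub>L 'a) set"
  assumes vN: "von_neumann_algebra M"
begin

lemma mem_bounded_ops: "A \<in> M \<Longrightarrow> A \<in> bounded_ops"
  using vN by (auto simp: von_neumann_algebra_def)

lemmas mem_scaleC = bounded_ops_scaleC[OF mem_bounded_ops]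
lemmas cinner_adj = cinner_op_adj[OF mem_bounded_ops]
lemmas cinner_adj' = cinner_op_adj'[OF mem_bounded_ops]
lemmas adj_adj = op_adj_op_adj[OF mem_bounded_ops]
lemmas adj_compose = op_adj_compose[OF mem_bounded_ops mem_bounded_ops]

lemma adj_mem: "A \<in> M \<Longrightarrow> op_adj A \<in> M"
  using vN by (auto simp: von_neumann_algebra_def)

lemma commutes: "A \<in> M \<Longrightarrow> U \<in> commutant M \<Longrightarrow> A (U x) = U (A x)"
  unfolding commutant_def by (metis (mono_tags, lifting) blinfun_apply_blinfun_compose mem_Collect_eq)

text \<open>The double commutant condition reduces every closure property of \<open>M\<close>, the
  one under strong limits included, to commutation with each \<open>U\<close> in the commutant,
  checked pointwise.\<close>

lemma memI:
  assumes "A \<in> bounded_ops" "\<And>U x. U \<in> commutant M \<Longrightarrow> A (U x) = U (A x)"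
  shows "A \<in> M"
proof -
  have "A \<in> commutant (commutant M)"
    unfolding commutant_def[of "commutant M"] using assms by (auto intro!: blinfun_eqI)
  then show ?thesis using vN by (simp add: von_neumann_algebra_def)
qed

lemma commutant_bounded_ops: "U \<in> commutant M \<Longrightarrow> U \<in> bounded_ops"
  by (simp add: commutant_def)

lemma id_mem: "id_blinfun \<in> M"
  by (rule memI) (auto simp: bounded_ops_def)

lemma zero_mem: "0 \<in> M"
  by (rule memI) (auto simp: bounded_ops_def blinfun.zero_right)

lemma compose_mem: "A \<in> M \<Longrightarrow> B \<in> M \<Longrightarrow> A o\<^sub>L B \<in> M"
  by (rule memI) (auto simp: bounded_ops_def mem_scaleC commutes)

lemma add_mem: "A \<in> M \<Longrightarrow> B \<in> M \<Longrightarrow> A + B \<in> M"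
  by (rule memI)
    (auto simp: bounded_ops_def mem_scaleC commutes blinfun.add_left blinfun.add_right scaleC_add_right)

lemma scaleC_mem: "A \<in> M \<Longrightarrow> op_scaleC c A \<in> M"
  by (rule memI)
    (auto simp: bounded_ops_def mem_scaleC commutes op_scaleC.rep_eq scaleC_scaleC mult.commute
      bounded_ops_scaleC[OF commutant_bounded_ops])

lemma scaleR_eq: "r *\<^sub>R A = op_scaleC (of_real r) A"
  by (rule blinfun_eqI) (simp add: op_scaleC.rep_eq scaleC_of_real blinfun.scaleR_left)

lemma scaleR_mem: "A \<in> M \<Longrightarrow> r *\<^sub>R A \<in> M"
  by (simp add: scaleR_eq scaleC_mem)

lemma uminus_mem: "A \<in> M \<Longrightarrow> - A \<in> M"
  using scaleR_mem[of A "-1"] by simp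

lemma diff_mem: "A \<in> M \<Longrightarrow> B \<in> M \<Longrightarrow> A - B \<in> M"
  using add_mem[OF _ uminus_mem, of A B] by simp

lemmas mem_intros = id_mem zero_mem compose_mem add_mem scaleC_mem scaleR_mem uminus_mem diff_mem
  adj_mem

lemma strong_limit_mem:
  assumes X: "\<And>n :: nat. X n \<in> M" and lim: "\<And>x. (\<lambda>n. X n x) \<longlonglongrightarrow> blinfun_apply P x"
  shows "P \<in> M"
proof (rule memI)
  show "P \<in> bounded_ops"
    unfolding bounded_ops_def
  proof clarify
    show "P (c *\<^sub>C x) = c *\<^sub>C P x" for c x
      using lim[of "c *\<^sub>C x"] tendsto_scaleC[OF lim[of x], of c] LIMSEQ_unique
      by (simp add: mem_scaleC[OF X]) blast
  qed
  show "P (U x) = U (P x)" if "U \<in> commutant M" for U x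
    using lim[of "U x"] blinfun.tendsto[OF tendsto_const lim, of U x] LIMSEQ_unique
    by (simp add: commutes[OF X that]) blast
qed

end


section \<open>Null projections\<close>

primrec op_power :: "('a::real_normed_vector \<Rightarrow>\<^sub>L 'a) \<Rightarrow> nat \<Rightarrow> 'a \<Rightarrow>\<^sub>L 'a"
  where "op_power K 0 = id_blinfun" | "op_power K (Suc n) = K o\<^sub>L op_power K n"

lemma op_power_apply: "op_power K n x = (blinfun_apply K ^^ n) x"
  by (induction n) auto

lemma (in vN_algebra) op_power_mem: "K \<in> M \<Longrightarrow> op_power K n \<in> M"
  by (induction n) (auto intro: mem_intros)

definition self_adjoint_contraction :: "('a::chilbert_space \<Rightarrow>\<^sub>L 'a) \<Rightarrow> bool"
  where "self_adjoint_contraction K \<longleftrightarrow>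
    K \<in> bounded_ops \<and> (\<forall>x y. cinner (K x) y = cinner x (K y)) \<and> (\<forall>x. norm (K x) \<le> norm x)"

text \<open>Even powers are taken because odd powers oscillate on an eigenvector for
  \<open>-1\<close>; the limit is the projection onto the vectors fixed by
  \<open>K o\<^sub>L K\<close>.\<close>

definition power_limit :: "('a::chilbert_space \<Rightarrow>\<^sub>L 'a) \<Rightarrow> 'a \<Rightarrow>\<^sub>L 'a"
  where "power_limit K = (THE P. \<forall>x. (\<lambda>n. op_power (K o\<^sub>L K) n x) \<longlonglongrightarrow> blinfun_apply P x)"

context
  fixes K :: "'a::chilbert_space \<Rightarrow>\<^sub>L 'a"
  assumes K: "self_adjoint_contraction K"
begin

lemma op_power_square: "op_power (K o\<^sub>L K) n x = (blinfun_apply K ^^ (2 * n)) x"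
  by (induction n) (auto simp: op_power_apply)

lemma cinner_funpow: "cinner ((blinfun_apply K ^^ n) x) y = cinner x ((blinfun_apply K ^^ n) y)"
  using K by (induction n arbitrary: x y) (auto simp: self_adjoint_contraction_def funpow_swap1)

lemma norm_funpow_le: "norm ((blinfun_apply K ^^ n) x) \<le> norm x"
  using K by (induction n) (auto simp: self_adjoint_contraction_def intro: order_trans)

text \<open>Self-adjointness moves powers across the inner product, so the total exponent
  \<open>2 * n + 2 * m\<close> can be split evenly.\<close>

lemma cinner_op_power:
  "cinner (op_power (K o\<^sub>L K) n x) (op_power (K o\<^sub>L K) m x) = of_real ((norm ((blinfun_apply K ^^ (n + m)) x))\<^sup>2)"
proof -
  have "cinner (op_power (K o\<^sub>L K) n x) (op_power (K o\<^sub>L K) m x)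
      = cinner x ((blinfun_apply K ^^ (2 * n + 2 * m)) x)"
    by (simp add: op_power_square cinner_funpow funpow_add)
  also have "2 * n + 2 * m = (n + m) + (n + m)" by simp
  also have "cinner x ((blinfun_apply K ^^ \<dots>) x)
      = cinner ((blinfun_apply K ^^ (n + m)) x) ((blinfun_apply K ^^ (n + m)) x)"
    unfolding funpow_add[of "n + m" "n + m"] by (simp only: o_apply cinner_funpow)
  finally show ?thesis by (simp add: cinner_self)
qed

lemma quadratic_form_op_power:
  "cinner (op_power (K o\<^sub>L K) n x) x = of_real ((norm ((blinfun_apply K ^^ n) x))\<^sup>2)"
  using cinner_op_power[of n x 0] by simp

lemma decseq_norm_funpow: "decseq (\<lambda>n. (norm ((blinfun_apply K ^^ n) x))\<^sup>2)"
  using K by (intro decseq_SucI power_mono) (auto simp: self_adjoint_contraction_def)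

text \<open>
  With \<open>b n = (norm (K\<^sup>n x))\<^sup>2\<close>, which decreases, the squared distance of \<open>K\<^sup>2\<^sup>n x\<close> and \<open>K\<^sup>2\<^sup>m x\<close>
  is \<open>b (2 * n) - 2 * b (n + m) + b (2 * m)\<close>.
\<close>

lemma Cauchy_op_power: "Cauchy (\<lambda>n. op_power (K o\<^sub>L K) n x)"
proof -
  define b where "b n = (norm ((blinfun_apply K ^^ n) x))\<^sup>2" for n
  have dec: "decseq b" unfolding b_def by (rule decseq_norm_funpow)
  have "b n \<ge> 0" for n by (simp add: b_def)
  then obtain l where l: "b \<longlonglongrightarrow> l" "\<And>n. l \<le> b n"
    using decseq_convergent[OF dec, of 0] by metis
  have "(norm (op_power (K o\<^sub>L K) m x - op_power (K o\<^sub>L K) n x))\<^sup>2 \<le> 1 * ((b m - l) + (b n - l))" for m n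
  proof -
    have nn: "(norm (op_power (K o\<^sub>L K) k x))\<^sup>2 = b (k + k)" for k
      using cinner_op_power[of k x k] by (simp add: cinner_self b_def flip: of_real_power)
    have "(norm (op_power (K o\<^sub>L K) m x - op_power (K o\<^sub>L K) n x))\<^sup>2 = b (m + m) - 2 * b (m + n) + b (n + n)"
      unfolding norm_diff_sq cinner_op_power nn by (simp add: b_def)
    also have "\<dots> \<le> b m - 2 * l + b n"
      using l(2)[of "m + n"] decseqD[OF dec, of m "m + m"] decseqD[OF dec, of n "n + n"] by simp
    finally show ?thesis by simp
  qed
  moreover have "(\<lambda>n. b n - l) \<longlonglongrightarrow> 0"
    using tendsto_diff[OF l(1) tendsto_const, of l] by simp
  ultimately show ?thesis by (intro Cauchy_if_norm_sq_le[where c = 1]) auto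
qed

lemma op_power_tendsto: "(\<lambda>n. op_power (K o\<^sub>L K) n x) \<longlonglongrightarrow> power_limit K x"
proof -
  have "norm (op_power (K o\<^sub>L K) n x) \<le> 1 * norm x" for n x
    using norm_funpow_le[of "2 * n" x] by (simp add: op_power_square)
  then obtain P where P: "\<And>x. (\<lambda>n. op_power (K o\<^sub>L K) n x) \<longlonglongrightarrow> blinfun_apply P x"
    using Cauchy_op_power by (rule strong_limit_exists) auto
  then have "power_limit K = P"
    unfolding power_limit_def
  proof (intro the_equality allI P)
    show "Q = P" if "\<forall>x. (\<lambda>n. op_power (K o\<^sub>L K) n x) \<longlonglongrightarrow> blinfun_apply Q x" for Q
      using that P by (intro strong_limit_unique[where X = "op_power (K o\<^sub>L K)"]) auto
  qed
  then show ?thesis using P by simp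
qed

lemma cinner_power_limit: "cinner (power_limit K x) y = cinner x (power_limit K y)"
proof (rule LIMSEQ_unique)
  show "(\<lambda>n. cinner (op_power (K o\<^sub>L K) n x) y) \<longlonglongrightarrow> cinner (power_limit K x) y"
    by (intro tendsto_cinner op_power_tendsto tendsto_const)
  show "(\<lambda>n. cinner (op_power (K o\<^sub>L K) n x) y) \<longlonglongrightarrow> cinner x (power_limit K y)"
    unfolding op_power_square cinner_funpow unfolding op_power_square[symmetric]
    by (intro tendsto_cinner op_power_tendsto tendsto_const)
qed

lemma op_adj_power_limit: "op_adj (power_limit K) = power_limit K"
  by (rule op_adj_unique) (rule cinner_power_limit)

text \<open>A vector fixed by \<open>K\<^sup>2\<close> gives a constant sequence, and shifting the
  index shows that \<open>K\<^sup>2\<close> fixes every limit. Together with self-adjointness this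
  makes \<open>power_limit K\<close> an orthogonal projection.\<close>

lemma power_limit_fixed_iff: "power_limit K x = x \<longleftrightarrow> K (K x) = x"
  and power_limit_idem: "power_limit K (power_limit K x) = power_limit K x"
proof -
  have fixd: "power_limit K y = y" if "K (K y) = y" for y
  proof -
    have "op_power (K o\<^sub>L K) n y = y" for n by (induction n) (simp_all add: that)
    then show ?thesis using op_power_tendsto[of y] by (simp add: LIMSEQ_const_iff)
  qed
  have inv: "K (K (power_limit K y)) = power_limit K y" for y
  proof (rule LIMSEQ_unique)
    show "(\<lambda>n. op_power (K o\<^sub>L K) (Suc n) y) \<longlonglongrightarrow> power_limit K y"
      using op_power_tendsto[of y] by (rule LIMSEQ_Suc)
    show "(\<lambda>n. op_power (K o\<^sub>L K) (Suc n) y) \<longlonglongrightarrow> K (K (power_limit K y))"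
      by (simp, intro blinfun.tendsto tendsto_const op_power_tendsto)
  qed
  show "power_limit K x = x \<longleftrightarrow> K (K x) = x" using fixd[of x] inv[of x] by metis
  show "power_limit K (power_limit K x) = power_limit K x" by (rule fixd[OF inv])
qed

end

lemma (in vN_algebra) power_limit_mem:
  assumes "self_adjoint_contraction K" "K \<in> M" shows "power_limit K \<in> M"
  using op_power_tendsto[OF assms(1)]
  by (rule strong_limit_mem[rotated]) (intro op_power_mem compose_mem assms)

text \<open>\<open>c\<close> stays a parameter because one value has to serve two operators:
  \<open>B\<close> and its adjoint in the factorisation, \<open>B\<close> and its image when null
  projections are transported along \<Phi>.\<close>

definition defect :: "real \<Rightarrow> ('a::chilbert_space \<Rightarrow>\<^sub>L 'a) \<Rightarrow> 'a \<Rightarrow>\<^sub>L 'a"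
  where "defect c B = id_blinfun - (1 / c) *\<^sub>R (op_adj B o\<^sub>L B)"

lemma defect_apply: "defect c B x = x - (1 / c) *\<^sub>R op_adj B (B x)"
  by (simp add: defect_def blinfun.diff_left blinfun.scaleR_left)

lemma (in vN_algebra) defect_mem: "B \<in> M \<Longrightarrow> defect c B \<in> M"
  unfolding defect_def by (intro mem_intros)

lemma scaleC_diff_right: "c *\<^sub>C (x - y) = c *\<^sub>C x - c *\<^sub>C (y :: 'a::chilbert_space)"
  by (rule linear_diff[OF bounded_linear.linear[OF bounded_linear_scaleC]])

lemma scaleC_scaleR: "c *\<^sub>C (r *\<^sub>R x) = r *\<^sub>R (c *\<^sub>C (x :: 'a::chilbert_space))"
  by (rule linear_cmul[OF bounded_linear.linear[OF bounded_linear_scaleC]])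

context
  fixes B :: "'a::chilbert_space \<Rightarrow>\<^sub>L 'a" and c :: real
  assumes B: "B \<in> bounded_ops" and c: "c > 0" "(norm B)\<^sup>2 \<le> c"
begin

lemma norm_adj_B_sq_le: "(norm (op_adj B (B x)))\<^sup>2 \<le> c * (norm (B x))\<^sup>2"
proof -
  have "(norm (op_adj B (B x)))\<^sup>2 \<le> (norm B * norm (B x))\<^sup>2"
    by (intro power_mono norm_op_adj_apply_le B) simp
  also have "\<dots> \<le> c * (norm (B x))\<^sup>2"
    using c by (simp add: power_mult_distrib mult_right_mono)
  finally show ?thesis .
qed

text \<open>In the expanded square the cross term contributes
  \<open>- 2 / c * (norm (B x))\<^sup>2\<close>, and the square of the correction at most half of
  that with the opposite sign.\<close>

lemma defect_self_adjoint_contraction: "self_adjoint_contraction (defect c B)"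
  unfolding self_adjoint_contraction_def
proof (intro conjI allI)
  show "defect c B \<in> bounded_ops"
    unfolding bounded_ops_def by (simp add: defect_apply bounded_ops_scaleC[OF B]
        bounded_ops_scaleC[OF op_adj_in_bounded_ops[OF B]] scaleC_diff_right scaleC_scaleR)
  show "cinner (defect c B x) y = cinner x (defect c B y)" for x y
    by (simp add: defect_apply cinner_diff_left cinner_diff_right cinner_scaleR_left
        cinner_scaleR_right flip: cinner_op_adj[OF B] cinner_op_adj'[OF B])
  show "norm (defect c B x) \<le> norm x" for x
  proof (rule power2_le_imp_le)
    have "(norm (defect c B x))\<^sup>2 = (norm x)\<^sup>2 - 2 / c * Re (cinner x (op_adj B (B x)))
        + 1 / c\<^sup>2 * (norm (op_adj B (B x)))\<^sup>2"
      unfolding defect_apply norm_diff_sq cinner_scaleR_right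
      by (simp add: power_divide power_mult_distrib)
    also have "Re (cinner x (op_adj B (B x))) = (norm (B x))\<^sup>2"
      by (simp add: cinner_self flip: cinner_op_adj[OF B])
    also have "1 / c\<^sup>2 * (norm (op_adj B (B x)))\<^sup>2 \<le> 1 / c\<^sup>2 * (c * (norm (B x))\<^sup>2)"
      by (intro mult_left_mono norm_adj_B_sq_le) simp
    also have "(norm x)\<^sup>2 - 2 / c * (norm (B x))\<^sup>2 + 1 / c\<^sup>2 * (c * (norm (B x))\<^sup>2)
        = (norm x)\<^sup>2 - 1 / c * (norm (B x))\<^sup>2"
      using c by (simp add: power2_eq_square field_simps)
    also have "\<dots> \<le> (norm x)\<^sup>2" using c by simp
    finally show "(norm (defect c B x))\<^sup>2 \<le> (norm x)\<^sup>2" by simp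
  qed simp
qed

text \<open>
  With \<open>H = B\<^sup>*B / c\<close> the condition reads \<open>H (2 x - H x) = 0\<close>, and \<open>2 - H\<close> is injective since
  \<open>H\<close> is a contraction.
\<close>

lemma defect_defect_eq_iff: "defect c B (defect c B x) = x \<longleftrightarrow> B x = 0"
proof
  define h where "h = (1 / c) *\<^sub>R op_adj B (B x)"
  assume "defect c B (defect c B x) = x"
  then have "x - h - ((1 / c) *\<^sub>R op_adj B (B x) - (1 / c) *\<^sub>R op_adj B (B h)) = x"
    by (simp only: defect_apply h_def blinfun.diff_right scaleR_diff_right)
  then have "h + h = (1 / c) *\<^sub>R op_adj B (B h)"
    unfolding h_def[symmetric] by (simp add: algebra_simps)
  then have "norm (2 *\<^sub>R h) = norm ((1 / c) *\<^sub>R op_adj B (B h))" by (simp only: scaleR_2)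
  then have "2 * norm h = 1 / c * norm (op_adj B (B h))"
    using c by simp
  also have "\<dots> \<le> 1 / c * (norm B * norm (B h))"
    using c by (intro mult_left_mono norm_op_adj_apply_le B) simp
  also have "\<dots> \<le> 1 / c * (norm B * (norm B * norm h))"
    using c by (intro mult_left_mono norm_blinfun) auto
  also have "\<dots> = (norm B)\<^sup>2 / c * norm h" by (simp add: power2_eq_square)
  also have "\<dots> \<le> 1 * norm h" using c by (intro mult_right_mono) auto
  finally have "h = 0" using norm_ge_zero[of h] by simp
  then have "op_adj B (B x) = 0" using c by (simp add: h_def)
  then have "cinner (B x) (B x) = 0" by (simp add: cinner_op_adj[OF B])
  then show "B x = 0" by (simp add: cinner_self)
qed (simp add: defect_apply blinfun.zero_right)

end

text \<open>The \<open>+ 1\<close> keeps the constant positive when \<open>B = 0\<close>.\<close>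

definition null_proj :: "('a::chilbert_space \<Rightarrow>\<^sub>L 'a) \<Rightarrow> 'a \<Rightarrow>\<^sub>L 'a"
  where "null_proj B = power_limit (defect ((norm B)\<^sup>2 + 1) B)"

context
  fixes B :: "'a::chilbert_space \<Rightarrow>\<^sub>L 'a"
  assumes B: "B \<in> bounded_ops"
begin

lemma null_proj_defect: "self_adjoint_contraction (defect ((norm B)\<^sup>2 + 1) B)"
  by (intro defect_self_adjoint_contraction B) (auto intro: add_nonneg_pos)

lemma op_adj_null_proj: "op_adj (null_proj B) = null_proj B"
  unfolding null_proj_def by (rule op_adj_power_limit[OF null_proj_defect])

lemma null_proj_idem: "null_proj B (null_proj B x) = null_proj B x"
  unfolding null_proj_def by (rule power_limit_idem[OF null_proj_defect])

lemma null_proj_eq_iff: "null_proj B x = x \<longleftrightarrow> B x = 0"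
  unfolding null_proj_def power_limit_fixed_iff[OF null_proj_defect]
  by (intro defect_defect_eq_iff B) (auto intro: add_nonneg_pos)

lemma op_null_proj [simp]: "B (null_proj B x) = 0"
  using null_proj_eq_iff null_proj_idem by blast

end

lemma (in vN_algebra) null_proj_mem: "B \<in> M \<Longrightarrow> null_proj B \<in> M"
  unfolding null_proj_def by (intro power_limit_mem null_proj_defect defect_mem mem_bounded_ops)

text \<open>Each operator acts as the identity on the range of the other, and passing to adjoints
  identifies them. This frees the null projection from the constant used to build it.\<close>

lemma null_proj_unique:
  assumes B: "B \<in> bounded_ops" and P: "P \<in> bounded_ops" "op_adj P = P"
    and idem: "\<And>x. P (P x) = P x" and fixd: "\<And>x. P x = x \<longleftrightarrow> B x = 0"
  shows "P = null_proj B"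
proof (rule blinfun_eqI, rule cinner_ext)
  fix x z
  let ?Q = "null_proj B"
  have Q: "cinner (?Q x) y = cinner x (?Q y)" for x y
    using cinner_power_limit[OF null_proj_defect[OF B]] by (simp add: null_proj_def)
  have 1: "P (?Q y) = ?Q y" for y using fixd op_null_proj[OF B] by blast
  have 2: "?Q (P y) = P y" for y using fixd idem null_proj_eq_iff[OF B] by blast
  have "cinner z (P x) = cinner z (?Q (P x))" by (simp add: 2)
  also have "\<dots> = cinner (P (?Q z)) x" by (simp add: Q cinner_op_adj[OF P(1)] P(2))
  also have "\<dots> = cinner z (?Q x)" by (simp add: 1 Q)
  finally show "cinner z (P x) = cinner z (?Q x)" .
qed


section \<open>Factorisation\<close>

text \<open>
  \<open>L\<close> and \<open>L'\<close> are the squares of \<open>1 - B\<^sup>*B / c\<close> and \<open>1 - BB\<^sup>* / c\<close>. Both \<open>1 - L\<^sup>n\<close> and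
  \<open>1 - L'\<^sup>n\<close> are expressed through one polynomial \<open>G\<close> in \<open>B\<^sup>*B\<close>.
\<close>

lemma (in vN_algebra) defect_power_factors:
  assumes B: "B \<in> M" and c: "c > 0"
  defines "L \<equiv> defect c B o\<^sub>L defect c B"
    and "L' \<equiv> defect c (op_adj B) o\<^sub>L defect c (op_adj B)"
  shows "\<exists>G\<in>M. (\<forall>x. (1 / c) *\<^sub>R G (op_adj B (B x)) = x - op_power L n x)
    \<and> (\<forall>y. (1 / c) *\<^sub>R B (G (op_adj B y)) = y - op_power L' n y)"
proof (induction n)
  case 0
  show ?case by (intro bexI[of _ 0]) (auto intro: zero_mem simp: blinfun.zero_right)
next
  case (Suc n)
  then obtain G where G: "G \<in> M"
    and GL: "\<And>x. (1 / c) *\<^sub>R G (op_adj B (B x)) = x - op_power L n x"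
    and GL': "\<And>y. (1 / c) *\<^sub>R B (G (op_adj B y)) = y - op_power L' n y"
    by blast
  note simps = blinfun.add_right blinfun.add_left blinfun.diff_right blinfun.scaleR_right
    scaleR_diff_right scaleR_add_right
  \<comment> \<open>From \<open>1 - L = (1 - K) (1 + K)\<close> with \<open>K = defect c B\<close>:
    the summand \<open>1 + K\<close> accounts for \<open>1 - L\<close>, the summand
    \<open>G L\<close> for the step from \<open>L\<close> to its power \<open>n + 1\<close>.\<close>
  let ?G = "(G o\<^sub>L L) + (id_blinfun + defect c B)"
  have adj: "L (op_adj B y) = op_adj B (L' y)" for y
    by (simp add: L_def L'_def defect_apply adj_adj[OF B] simps)
  have comm: "L (op_adj B (B x)) = op_adj B (B (L x))" for x
    by (simp add: L_def defect_apply simps)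
  have swap: "op_power T (Suc n) x = op_power T n (T x)" for T :: "'a \<Rightarrow>\<^sub>L 'a" and x
    by (simp add: op_power_apply funpow_swap1)
  have L: "L x = x - (1 / c) *\<^sub>R op_adj B (B x) - (1 / c) *\<^sub>R defect c B (op_adj B (B x))" for x
    by (simp add: L_def defect_apply simps)
  have L': "L' y = y - (1 / c) *\<^sub>R B (op_adj B y) - (1 / c) *\<^sub>R B (defect c B (op_adj B y))" for y
    by (simp add: L'_def defect_apply adj_adj[OF B] simps)
  have "?G \<in> M" unfolding L_def by (intro mem_intros G defect_mem B)
  moreover have "(1 / c) *\<^sub>R ?G (op_adj B (B x)) = x - op_power L (Suc n) x" for x
  proof -
    have "(1 / c) *\<^sub>R op_adj B (B x) + (1 / c) *\<^sub>R defect c B (op_adj B (B x)) = x - L x"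
      using L[of x] by (simp add: algebra_simps)
    moreover have "(1 / c) *\<^sub>R G (L (op_adj B (B x))) = L x - op_power L n (L x)"
      by (simp only: comm GL)
    ultimately show ?thesis unfolding swap by (simp add: blinfun.add_left scaleR_add_right)
  qed
  moreover have "(1 / c) *\<^sub>R B (?G (op_adj B y)) = y - op_power L' (Suc n) y" for y
  proof -
    have "(1 / c) *\<^sub>R B (op_adj B y) + (1 / c) *\<^sub>R B (defect c B (op_adj B y)) = y - L' y"
      using L'[of y] by (simp add: algebra_simps)
    moreover have "(1 / c) *\<^sub>R B (G (L (op_adj B y))) = L' y - op_power L' n (L' y)"
      by (simp only: adj GL')
    ultimately show ?thesis
      unfolding swap by (simp add: blinfun.add_left blinfun.add_right scaleR_add_right)
  qed
  ultimately show ?case by blast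
qed

text \<open>The factor is the strong limit of \<open>A G\<^sub>n B\<^sup>* / c\<close>.\<close>

lemma (in vN_algebra) Douglas_factorization:
  assumes A: "A \<in> M" and B: "B \<in> M" and C: "C \<ge> 0"
    and le: "\<And>x. norm (A x) \<le> C * norm (B x)"
  shows "\<exists>Z\<in>M. A = Z o\<^sub>L B"
proof -
  define c where "c = (norm B)\<^sup>2 + 1"
  have c: "c > 0" "(norm B)\<^sup>2 \<le> c" by (auto simp: c_def intro: add_nonneg_pos)
  have "norm (op_adj B) \<le> norm B"
    by (intro norm_blinfun_bound norm_op_adj_apply_le mem_bounded_ops B) simp
  then have c': "(norm (op_adj B))\<^sup>2 \<le> c" using c(2) by (meson norm_ge_zero order_trans power_mono)
  define K where "K = defect c B"
  define K' where "K' = defect c (op_adj B)"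
  have K: "self_adjoint_contraction K" and K': "self_adjoint_contraction K'"
    unfolding K_def K'_def
    by (intro defect_self_adjoint_contraction mem_bounded_ops adj_mem B c c')+
  obtain G where G: "\<And>n. G n \<in> M"
    and GL: "\<And>n x. (1 / c) *\<^sub>R G n (op_adj B (B x)) = x - op_power (K o\<^sub>L K) n x"
    and GL': "\<And>n y. (1 / c) *\<^sub>R B (G n (op_adj B y)) = y - op_power (K' o\<^sub>L K') n y"
    using defect_power_factors[OF B c(1)] unfolding K_def K'_def by metis
  define Z where "Z n = (1 / c) *\<^sub>R (A o\<^sub>L (G n o\<^sub>L op_adj B))" for n
  have Z_apply: "Z n y = A ((1 / c) *\<^sub>R G n (op_adj B y))" for n y
    by (simp add: Z_def blinfun.scaleR_left blinfun.scaleR_right)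
  have BG: "B ((1 / c) *\<^sub>R G n (op_adj B y)) = y - op_power (K' o\<^sub>L K') n y" for n y
    by (simp add: blinfun.scaleR_right GL')
  have Z_mem: "Z n \<in> M" for n unfolding Z_def by (intro mem_intros A B G)
  \<comment> \<open>The hypothesis trades \<open>A\<close> for \<open>B\<close>, and
    \<open>B\<close> applied to the inner argument gives \<open>1\<close> minus a power of
    \<open>K' o\<^sub>L K'\<close>, which is uniformly bounded and strongly Cauchy. The factors
    \<open>G n\<close> themselves need not stay bounded.\<close>
  have Z_bound: "norm (Z n y) \<le> C * 2 * norm y" for n y
  proof -
    have "norm (Z n y) \<le> C * norm (y - op_power (K' o\<^sub>L K') n y)"
      unfolding Z_apply BG[symmetric] by (rule le)
    also have "\<dots> \<le> C * (norm y + norm y)"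
      by (intro mult_left_mono norm_triangle_le_diff add_mono order_refl C)
        (simp add: op_power_square[OF K'] norm_funpow_le[OF K'])
    finally show ?thesis by simp
  qed
  have "Cauchy (\<lambda>n. Z n y)" for y
  proof (rule metric_CauchyI)
    fix e :: real assume "e > 0"
    then have "e / (C + 1) > 0" using C by simp
    then obtain N where N: "\<And>m n. m \<ge> N \<Longrightarrow> n \<ge> N \<Longrightarrow>
        dist (op_power (K' o\<^sub>L K') m y) (op_power (K' o\<^sub>L K') n y) < e / (C + 1)"
      using metric_CauchyD[OF Cauchy_op_power[OF K']] by blast
    have "dist (Z m y) (Z n y) < e" if "m \<ge> N" "n \<ge> N" for m n
    proof -
      have "dist (Z m y) (Z n y)
          = norm (A ((1 / c) *\<^sub>R G m (op_adj B y) - (1 / c) *\<^sub>R G n (op_adj B y)))"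
        by (simp add: dist_norm Z_apply blinfun.diff_right)
      also have "\<dots> \<le> C * norm (B ((1 / c) *\<^sub>R G m (op_adj B y) - (1 / c) *\<^sub>R G n (op_adj B y)))"
        by (rule le)
      also have "\<dots> = C * dist (op_power (K' o\<^sub>L K') m y) (op_power (K' o\<^sub>L K') n y)"
        unfolding blinfun.diff_right BG dist_norm by (simp add: norm_minus_commute)
      also have "\<dots> \<le> C * (e / (C + 1))"
        using N[OF that] C by (intro mult_left_mono) auto
      also have "\<dots> < e" using C \<open>e > 0\<close> by (simp add: field_simps)
      finally show ?thesis .
    qed
    then show "\<exists>N. \<forall>m\<ge>N. \<forall>n\<ge>N. dist (Z m y) (Z n y) < e" by blast
  qed
  with Z_bound obtain W where W: "\<And>y. (\<lambda>n. Z n y) \<longlonglongrightarrow> blinfun_apply W y"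
    by (rule strong_limit_exists) auto
  have "W (B x) = A x" for x
  proof (rule LIMSEQ_unique)
    show "(\<lambda>n. Z n (B x)) \<longlonglongrightarrow> W (B x)" by (rule W)
    \<comment> \<open>On the range of \<open>B\<close> the sequence tends to
      \<open>A (x - power_limit K x)\<close>; the part removed lies in the null space of
      \<open>B\<close>, hence in that of \<open>A\<close>.\<close>
    have "B (power_limit K x) = 0"
      using defect_defect_eq_iff[OF mem_bounded_ops[OF B] c] power_limit_fixed_iff[OF K]
        power_limit_idem[OF K] K_def by metis
    then have "A (power_limit K x) = 0" using le[of "power_limit K x"] by simp
    moreover have "(\<lambda>n. A (x - op_power (K o\<^sub>L K) n x)) \<longlonglongrightarrow> A (x - power_limit K x)"
      by (intro blinfun.tendsto tendsto_diff tendsto_const op_power_tendsto K)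
    ultimately show "(\<lambda>n. Z n (B x)) \<longlonglongrightarrow> A x"
      by (simp add: Z_apply GL blinfun.diff_right)
  qed
  then have "A = W o\<^sub>L B" by (intro blinfun_eqI) simp
  then show ?thesis using strong_limit_mem[OF Z_mem W] by blast
qed

text \<open>Uniform boundedness for the functionals \<open>\<lambda>x. cinner x u\<close>: by Baire,
  one of the closed sets \<open>F n\<close> contains a ball, on which all of them are bounded by
  \<open>n\<close>.\<close>

lemma weakly_bounded_imp_bounded:
  fixes S :: "'a::chilbert_space set"
  assumes S: "\<And>x. \<exists>c. \<forall>u\<in>S. cmod (cinner x u) \<le> c"
  obtains C where "C \<ge> 0" "\<And>u. u \<in> S \<Longrightarrow> norm u \<le> C"
proof -
  define F where "F n = (\<Inter>u\<in>S. {x :: 'a. cmod (cinner x u) \<le> real n})" for n :: nat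
  have closed_F: "closed (F n)" for n
    unfolding F_def
    by (intro closed_INT ballI closed_Collect_le continuous_intros
        linear_continuous_on bounded_bilinear.bounded_linear_left[OF bounded_bilinear_cinner])
  have UN: "(\<Union>n. F n) = UNIV"
  proof (intro equalityI subsetI UNIV_I)
    fix x :: 'a
    obtain c where "\<forall>u\<in>S. cmod (cinner x u) \<le> c" using S by blast
    moreover obtain n where "c \<le> real n" using real_arch_simple by blast
    ultimately show "x \<in> (\<Union>n. F n)" unfolding F_def by (auto intro: order_trans)
  qed
  have "\<exists>n. interior (F n) \<noteq> {}"
  proof (rule ccontr)
    assume "\<not> ?thesis"
    then have "closedin Met_TC.mtopology T \<and> Met_TC.mtopology interior_of T = {}" if "T \<in> range F" for T
      using that closed_F by auto
    moreover have "Met_TC.mcomplete TYPE('a)"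
      by (auto simp: Met_TC.mcomplete_def Cauchy_convergent_iff convergent_def)
    ultimately have "Met_TC.mtopology interior_of (\<Union>(range F)) = {}"
      by (intro Met_TC.metric_Baire_category_alt) auto
    then show False using UN by simp
  qed
  then obtain n x0 r where r: "r > 0" and ball: "ball x0 r \<subseteq> F n"
    by (meson all_not_in_conv mem_interior)
  show ?thesis
  proof (rule that[of "4 * real n / r"])
    fix u assume u: "u \<in> S"
    show "norm u \<le> 4 * real n / r"
    proof (cases "u = 0")
      case False
      \<comment> \<open>A step of length \<open>r / 2\<close> in the direction of \<open>u\<close>
        stays in the ball. Its inner product with \<open>u\<close> is \<open>r / 2 * norm u\<close>
        and at most \<open>2 * real n\<close>, whence the constant
        \<open>4 * real n / r\<close>.\<close>
      define h where "h = (r / (2 * norm u)) *\<^sub>R u"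
      have "norm h = r / 2" using False r by (simp add: h_def)
      then have "x0 \<in> F n" "x0 + h \<in> F n" using ball r by (auto simp: subset_eq dist_norm)
      then have "cmod (cinner x0 u) \<le> real n" "cmod (cinner (x0 + h) u) \<le> real n"
        using u by (auto simp: F_def)
      then have "cmod (cinner h u) \<le> 2 * real n"
        using norm_triangle_ineq4[of "cinner (x0 + h) u" "cinner x0 u"]
        by (simp add: cinner_add_left)
      also have "cinner h u = of_real (r / 2 * norm u)"
        using False by (simp add: h_def cinner_scaleR_left cinner_self power2_eq_square)
      finally have "r / 2 * norm u \<le> 2 * real n" using r by (simp add: norm_mult)
      then show ?thesis using r by (simp add: field_simps)
    qed (use r in simp)
  qed (use r in simp)
qed

text \<open>If \<open>A x = B z\<close>, then
  \<open>cinner x (op_adj A w) = cinner z (op_adj B w)\<close>. So the vectors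
  \<open>op_adj A w\<close> with \<open>norm (op_adj B w) \<le> 1\<close> are weakly bounded, hence
  bounded.\<close>

lemma range_subset_imp_norm_adj_le:
  fixes A B :: "'a::chilbert_space \<Rightarrow>\<^sub>L 'a"
  assumes A: "A \<in> bounded_ops" and B: "B \<in> bounded_ops"
    and sub: "range (blinfun_apply A) \<subseteq> range (blinfun_apply B)"
  obtains C where "C \<ge> 0" "\<And>w. norm (op_adj A w) \<le> C * norm (op_adj B w)"
proof -
  have pt: "\<exists>c. \<forall>w. cmod (cinner x (op_adj A w)) \<le> c * norm (op_adj B w)" for x
  proof -
    obtain z where z: "A x = B z" using sub by blast
    have "cmod (cinner x (op_adj A w)) \<le> norm z * norm (op_adj B w)" for w
      using cmod_cinner_le[of z "op_adj B w"] by (simp add: z flip: cinner_op_adj[OF A] cinner_op_adj[OF B])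
    then show ?thesis by blast
  qed
  define S where "S = (\<lambda>w. op_adj A w) ` {w. norm (op_adj B w) \<le> 1}"
  have "\<exists>c. \<forall>u\<in>S. cmod (cinner x u) \<le> c" for x
  proof -
    obtain c where c: "\<And>w. cmod (cinner x (op_adj A w)) \<le> c * norm (op_adj B w)" using pt by blast
    have "cmod (cinner x (op_adj A w)) \<le> \<bar>c\<bar>" if "norm (op_adj B w) \<le> 1" for w
    proof -
      have "c * norm (op_adj B w) \<le> \<bar>c\<bar> * 1"
        using that by (intro mult_mono) auto
      then show ?thesis using c[of w] by linarith
    qed
    then show ?thesis unfolding S_def by blast
  qed
  then obtain C where C: "C \<ge> 0" "\<And>u. u \<in> S \<Longrightarrow> norm u \<le> C"
    by (rule weakly_bounded_imp_bounded) blast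
  show ?thesis
  proof (rule that[OF C(1)])
    fix w
    show "norm (op_adj A w) \<le> C * norm (op_adj B w)"
    proof (cases "op_adj B w = 0")
      case True
      \<comment> \<open>Normalising \<open>op_adj B w\<close> is impossible here; the pointwise
        bound at the vector \<open>op_adj A w\<close> itself forces that vector to vanish.\<close>
      obtain c where "cmod (cinner (op_adj A w) (op_adj A w)) \<le> c * norm (op_adj B w)"
        using pt by blast
      then show ?thesis using True by (simp add: cinner_self)
    next
      case False
      define k where "k = 1 / norm (op_adj B w)"
      have "op_adj A (k *\<^sub>R w) \<in> S"
        unfolding S_def using False by (intro imageI) (simp add: blinfun.scaleR_right k_def)
      then have "norm (op_adj A (k *\<^sub>R w)) \<le> C" by (rule C(2))
      then show ?thesis using False by (simp add: blinfun.scaleR_right k_def field_simps)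
    qed
  qed
qed

text \<open>The inclusion yields a norm inequality between adjoints, so the factorisation is carried
  out for \<open>op_adj A\<close> and \<open>op_adj B\<close>, and the adjoint of the factor is
  taken.\<close>

lemma (in vN_algebra) range_subset_imp_factor:
  assumes A: "A \<in> M" and B: "B \<in> M"
    and sub: "range (blinfun_apply A) \<subseteq> range (blinfun_apply B)"
  shows "\<exists>X\<in>M. A = B o\<^sub>L X"
proof -
  obtain C where "C \<ge> 0" "\<And>w. norm (op_adj A w) \<le> C * norm (op_adj B w)"
    using range_subset_imp_norm_adj_le[OF mem_bounded_ops[OF A] mem_bounded_ops[OF B] sub] by blast
  then obtain Z where Z: "Z \<in> M" "op_adj A = Z o\<^sub>L op_adj B"
    using Douglas_factorization[OF adj_mem[OF A] adj_mem[OF B]] by blast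
  then have "A = B o\<^sub>L op_adj Z"
    by (metis A B adj_adj adj_compose adj_mem)
  then show ?thesis using Z(1) adj_mem by blast
qed


section \<open>Square roots and contractivity of homomorphisms\<close>

primrec sqrt_iter :: "('a::real_normed_vector \<Rightarrow>\<^sub>L 'a) \<Rightarrow> nat \<Rightarrow> 'a \<Rightarrow>\<^sub>L 'a"
  where "sqrt_iter K 0 = 0"
  | "sqrt_iter K (Suc n) = (1 / 2) *\<^sub>R (K + (sqrt_iter K n o\<^sub>L sqrt_iter K n))"

text \<open>The iteration of \<open>sqrt_iter\<close> at the scalar \<open>K = 1\<close>; it
  majorises the operator iteration for every contraction \<open>K\<close>.\<close>

primrec sqrt_bound :: "nat \<Rightarrow> real"
  where "sqrt_bound 0 = 0" | "sqrt_bound (Suc n) = (1 + (sqrt_bound n)\<^sup>2) / 2"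

lemma sqrt_bound_bounds: "0 \<le> sqrt_bound n \<and> sqrt_bound n \<le> 1"
  by (induction n) (auto simp: power_le_one)

lemma sqrt_bound_convergent: "convergent sqrt_bound"
proof (rule Bseq_mono_convergent)
  show "Bseq sqrt_bound" using sqrt_bound_bounds by (intro BseqI'[of _ 1]) auto
  \<comment> \<open>The increment is \<open>(1 - sqrt_bound n)\<^sup>2 / 2\<close>.\<close>
  have "sqrt_bound n \<le> sqrt_bound (Suc n)" for n
    using sum_squares_ge_zero[of "sqrt_bound n - 1" 0] by (simp add: power2_eq_square algebra_simps)
  then show "\<forall>m n. m \<le> n \<longrightarrow> sqrt_bound m \<le> sqrt_bound n"
    using lift_Suc_mono_le by blast
qed

text \<open>By \<open>X\<^sup>2 - Y\<^sup>2 = X (X - Y) + (X - Y) Y\<close>, increments of the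
  operator iteration are dominated by those of the scalar one, so convergence of the latter gives
  convergence in norm.\<close>

lemma norm_sqrt_iter_diff_le:
  assumes K: "norm K \<le> 1" and "n \<le> m"
  shows "norm (sqrt_iter K m - sqrt_iter K n) \<le> sqrt_bound m - sqrt_bound n"
proof -
  have bound: "norm (sqrt_iter K m) \<le> sqrt_bound m" for m
  proof (induction m)
    case (Suc m)
    have "norm (sqrt_iter K m o\<^sub>L sqrt_iter K m) \<le> (sqrt_bound m)\<^sup>2"
      unfolding power2_eq_square using Suc
      by (intro order_trans[OF norm_blinfun_compose] mult_mono) (auto simp: sqrt_bound_bounds)
    then show ?case using K norm_triangle_ineq[of K "sqrt_iter K m o\<^sub>L sqrt_iter K m"] by simp
  qed simp
  show ?thesis
    using \<open>n \<le> m\<close>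
  proof (induction n arbitrary: m)
    case 0
    then show ?case using bound by simp
  next
    case (Suc n)
    then obtain k where k: "m = Suc k" "n \<le> k" by (cases m) auto
    let ?X = "sqrt_iter K k" and ?Y = "sqrt_iter K n"
    have "(?X o\<^sub>L ?X) - (?Y o\<^sub>L ?Y) = (?X o\<^sub>L (?X - ?Y)) + ((?X - ?Y) o\<^sub>L ?Y)"
      by (rule blinfun_eqI) (simp add: blinfun.diff_left blinfun.add_left blinfun.diff_right)
    also have "norm \<dots> \<le> norm ?X * norm (?X - ?Y) + norm (?X - ?Y) * norm ?Y"
      by (intro norm_triangle_le add_mono norm_blinfun_compose)
    also have "\<dots> \<le> sqrt_bound k * (sqrt_bound k - sqrt_bound n) + (sqrt_bound k - sqrt_bound n) * sqrt_bound n"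
      using Suc.IH[OF k(2)] order_trans[OF norm_ge_zero Suc.IH[OF k(2)]]
      by (intro add_mono mult_mono bound) (auto simp: sqrt_bound_bounds)
    also have "\<dots> = (sqrt_bound k)\<^sup>2 - (sqrt_bound n)\<^sup>2" by (simp add: power2_eq_square algebra_simps)
    finally have le: "norm ((?X o\<^sub>L ?X) - (?Y o\<^sub>L ?Y)) \<le> (sqrt_bound k)\<^sup>2 - (sqrt_bound n)\<^sup>2" .
    have "sqrt_iter K m - sqrt_iter K (Suc n) = (1 / 2) *\<^sub>R ((?X o\<^sub>L ?X) - (?Y o\<^sub>L ?Y))"
      by (simp add: k scaleR_diff_right scaleR_add_right)
    then have "norm (sqrt_iter K m - sqrt_iter K (Suc n)) = 1 / 2 * norm ((?X o\<^sub>L ?X) - (?Y o\<^sub>L ?Y))"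
      by (simp only: norm_scaleR)
    then show ?case using le by (simp add: k field_simps)
  qed
qed

text \<open>
  The limit \<open>Y\<close> of the iteration satisfies \<open>2 Y = K + Y\<^sup>2\<close>, so \<open>(1 - Y)\<^sup>2 = 1 - K\<close>.
\<close>

lemma (in vN_algebra) square_root_exists:
  assumes K: "K \<in> M" and adj: "op_adj K = K" and norm: "norm K \<le> 1"
  shows "\<exists>R\<in>M. op_adj R = R \<and> id_blinfun - K = R o\<^sub>L R"
proof -
  have "Cauchy (sqrt_iter K)"
  proof (rule metric_CauchyI)
    fix e :: real assume "e > 0"
    then obtain N where N: "\<And>m n. m \<ge> N \<Longrightarrow> n \<ge> N \<Longrightarrow> dist (sqrt_bound m) (sqrt_bound n) < e"
      using metric_CauchyD[OF convergent_Cauchy[OF sqrt_bound_convergent]] by blast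
    have le: "norm (sqrt_iter K m - sqrt_iter K n) \<le> \<bar>sqrt_bound m - sqrt_bound n\<bar>" for m n
      using norm_sqrt_iter_diff_le[OF norm, of n m] norm_sqrt_iter_diff_le[OF norm, of m n]
      by (cases "n \<le> m") (auto simp: norm_minus_commute)
    have "dist (sqrt_iter K m) (sqrt_iter K n) < e" if "m \<ge> N" "n \<ge> N" for m n
      using le[of m n] N[OF that] by (simp add: dist_norm)
    then show "\<exists>N. \<forall>m\<ge>N. \<forall>n\<ge>N. dist (sqrt_iter K m) (sqrt_iter K n) < e" by blast
  qed
  then obtain Y where Y: "sqrt_iter K \<longlonglongrightarrow> Y" by (auto simp: Cauchy_convergent_iff convergent_def)
  have Yx: "(\<lambda>n. sqrt_iter K n x) \<longlonglongrightarrow> Y x" for x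
    by (intro blinfun.tendsto Y tendsto_const)
  have mem: "sqrt_iter K n \<in> M" for n
    by (induction n) (auto intro: mem_intros K)
  then have YM: "Y \<in> M" using Yx by (rule strong_limit_mem)
  have iter_adj: "cinner (sqrt_iter K n x) y = cinner x (sqrt_iter K n y)" for n x y
  proof (induction n arbitrary: x y)
    case (Suc n)
    then show ?case
      by (simp add: blinfun.scaleR_left blinfun.add_left cinner_simps cinner_adj[OF K] adj)
  qed simp
  have Y_adj: "cinner (Y x) y = cinner x (Y y)" for x y
  proof (rule LIMSEQ_unique)
    show "(\<lambda>n. cinner (sqrt_iter K n x) y) \<longlonglongrightarrow> cinner (Y x) y"
      by (intro tendsto_cinner Yx tendsto_const)
    show "(\<lambda>n. cinner (sqrt_iter K n x) y) \<longlonglongrightarrow> cinner x (Y y)"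
      unfolding iter_adj by (intro tendsto_cinner Yx tendsto_const)
  qed
  have Y_eq: "Y = (1 / 2) *\<^sub>R (K + (Y o\<^sub>L Y))"
  proof (rule LIMSEQ_unique)
    show "(\<lambda>n. sqrt_iter K (Suc n)) \<longlonglongrightarrow> Y" using Y by (rule LIMSEQ_Suc)
    show "(\<lambda>n. sqrt_iter K (Suc n)) \<longlonglongrightarrow> (1 / 2) *\<^sub>R (K + (Y o\<^sub>L Y))"
      unfolding sqrt_iter.simps
      by (intro tendsto_intros bounded_bilinear.tendsto[OF bounded_bilinear_blinfun_compose] Y)
  qed
  have "2 *\<^sub>R Y = K + (Y o\<^sub>L Y)" by (subst Y_eq) simp
  then have 2: "Y x + Y x = K x + Y (Y x)" for x
    by (metis blinfun.add_left blinfun_apply_blinfun_compose scaleR_2)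
  show ?thesis
  proof (intro bexI[of _ "id_blinfun - Y"] conjI)
    show "op_adj (id_blinfun - Y) = id_blinfun - Y"
      by (rule op_adj_unique) (simp add: blinfun.diff_left cinner_diff_left cinner_diff_right Y_adj)
    show "id_blinfun - K = (id_blinfun - Y) o\<^sub>L (id_blinfun - Y)"
    proof (rule blinfun_eqI)
      show "(id_blinfun - K) x = ((id_blinfun - Y) o\<^sub>L (id_blinfun - Y)) x" for x
        using 2[of x] by (simp add: blinfun.diff_left blinfun.diff_right algebra_simps)
    qed
    show "id_blinfun - Y \<in> M" by (intro mem_intros YM)
  qed
qed

section \<open>Unital star homomorphisms are contractions\<close>

locale vN_hom = dom: vN_algebra M + cod: vN_algebra N
  for M :: "('a::chilbert_space \<Rightarrow>\<^sub>L 'a) set" and N :: "('b::chilbert_space \<Rightarrow>\<^sub>L 'b) set" +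
  fixes \<Phi> :: "('a \<Rightarrow>\<^sub>L 'a) \<Rightarrow> ('b \<Rightarrow>\<^sub>L 'b)"
  assumes star_hom: "unital_star_hom M N \<Phi>"
begin

lemma hom_mem: "A \<in> M \<Longrightarrow> \<Phi> A \<in> N"
  and hom_add: "A \<in> M \<Longrightarrow> B \<in> M \<Longrightarrow> \<Phi> (A + B) = \<Phi> A + \<Phi> B"
  and hom_scaleC: "A \<in> M \<Longrightarrow> \<Phi> (op_scaleC k A) = op_scaleC k (\<Phi> A)"
  and hom_compose: "A \<in> M \<Longrightarrow> B \<in> M \<Longrightarrow> \<Phi> (A o\<^sub>L B) = \<Phi> A o\<^sub>L \<Phi> B"
  and hom_adj: "A \<in> M \<Longrightarrow> \<Phi> (op_adj A) = op_adj (\<Phi> A)"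
  and hom_id: "\<Phi> id_blinfun = id_blinfun"
  using star_hom by (auto simp: unital_star_hom_def)

lemma hom_zero: "\<Phi> 0 = 0"
  using hom_add[OF dom.zero_mem dom.zero_mem] by simp

lemma hom_scaleR: "A \<in> M \<Longrightarrow> \<Phi> (r *\<^sub>R A) = r *\<^sub>R \<Phi> A"
  by (simp add: dom.scaleR_eq cod.scaleR_eq hom_scaleC)

lemma hom_uminus: "A \<in> M \<Longrightarrow> \<Phi> (- A) = - \<Phi> A"
  using hom_scaleR[of A "-1"] by simp

lemma hom_diff: "A \<in> M \<Longrightarrow> B \<in> M \<Longrightarrow> \<Phi> (A - B) = \<Phi> A - \<Phi> B"
  using hom_add[OF _ dom.uminus_mem, of A B] by (simp add: hom_uminus)

text \<open>The operator \<open>1 - A\<^sup>*A / (norm A)\<^sup>2\<close> is the square of a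
  self-adjoint \<open>R\<close> in \<open>M\<close>, so its image is the square of
  \<open>\<Phi> R\<close> and has a nonnegative quadratic form. This lets a constant chosen for an
  operator serve for its image.\<close>

lemma hom_contractive:
  assumes A: "A \<in> M" shows "norm (\<Phi> A) \<le> norm A"
proof (cases "A = 0")
  case True
  then show ?thesis by (simp add: hom_zero)
next
  case False
  define K where "K = (1 / (norm A)\<^sup>2) *\<^sub>R (op_adj A o\<^sub>L A)"
  have K: "K \<in> M" unfolding K_def by (intro dom.mem_intros A)
  have "norm (K x) \<le> 1 * norm x" for x
  proof -
    have "norm (op_adj A (A x)) \<le> norm A * (norm A * norm x)"
      by (intro order_trans[OF norm_op_adj_apply_le[OF dom.mem_bounded_ops[OF A]]] mult_left_mono norm_blinfun) simp
    then show ?thesis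
      using False by (simp add: K_def blinfun.scaleR_left power2_eq_square field_simps)
  qed
  then have "norm K \<le> 1" by (intro norm_blinfun_bound) auto
  moreover have "op_adj K = K"
    by (rule op_adj_unique)
      (simp add: K_def blinfun.scaleR_left cinner_simps flip: dom.cinner_adj[OF A] dom.cinner_adj'[OF A])
  ultimately obtain R where R: "R \<in> M" "op_adj R = R" "id_blinfun - K = R o\<^sub>L R"
    using dom.square_root_exists[OF K] by blast
  have RN: "\<Phi> R \<in> N" "op_adj (\<Phi> R) = \<Phi> R" using hom_mem[OF R(1)] hom_adj[OF R(1)] R(2) by auto
  have eq: "id_blinfun - (1 / (norm A)\<^sup>2) *\<^sub>R (op_adj (\<Phi> A) o\<^sub>L \<Phi> A) = \<Phi> R o\<^sub>L \<Phi> R"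
    using arg_cong[OF R(3), of \<Phi>] A K R(1)
    by (simp add: hom_diff hom_id hom_compose hom_scaleR hom_adj K_def dom.mem_intros)
  have "norm (\<Phi> A x) \<le> norm A * norm x" for x
  proof (rule power2_le_imp_le)
    have "cinner (x - (1 / (norm A)\<^sup>2) *\<^sub>R op_adj (\<Phi> A) (\<Phi> A x)) x = cinner (\<Phi> R (\<Phi> R x)) x"
      using arg_cong[OF eq, of "\<lambda>T. cinner (blinfun_apply T x) x"]
      by (simp add: blinfun.diff_left blinfun.scaleR_left)
    also have "\<dots> = of_real ((norm (\<Phi> R x))\<^sup>2)"
      by (simp add: cod.cinner_adj RN cinner_self)
    also have "cinner (x - (1 / (norm A)\<^sup>2) *\<^sub>R op_adj (\<Phi> A) (\<Phi> A x)) x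
        = of_real ((norm x)\<^sup>2 - (norm (\<Phi> A x))\<^sup>2 / (norm A)\<^sup>2)"
      using A by (simp add: cinner_simps cinner_self hom_mem flip: cod.cinner_adj')
    finally have "(norm x)\<^sup>2 - (norm (\<Phi> A x))\<^sup>2 / (norm A)\<^sup>2 = (norm (\<Phi> R x))\<^sup>2"
      by (simp only: of_real_eq_iff)
    then have "(norm (\<Phi> A x))\<^sup>2 / (norm A)\<^sup>2 \<le> (norm x)\<^sup>2"
      using zero_le_power2[of "norm (\<Phi> R x)"] by linarith
    then show "(norm (\<Phi> A x))\<^sup>2 \<le> (norm A * norm x)\<^sup>2"
      using False by (simp add: power_mult_distrib field_simps)
  qed simp
  then show ?thesis by (intro norm_blinfun_bound) auto
qed

end


section \<open>Two-by-two operator matrices\<close>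

instantiation prod :: (chilbert_space, chilbert_space) chilbert_space
begin

definition scaleC_prod :: "complex \<Rightarrow> 'a \<times> 'b \<Rightarrow> 'a \<times> 'b"
  where "scaleC_prod c p = (c *\<^sub>C fst p, c *\<^sub>C snd p)"

definition cinner_prod :: "'a \<times> 'b \<Rightarrow> 'a \<times> 'b \<Rightarrow> complex"
  where "cinner_prod p q = cinner (fst p) (fst q) + cinner (snd p) (snd q)"

instance
proof
  fix x y :: "'a \<times> 'b"
  show "cinner x y = cnj (cinner y x)"
    by (simp add: cinner_prod_def flip: cinner_commute)
  show "norm x = sqrt (Re (cinner x x))"
    by (simp add: cinner_prod_def norm_prod_def cinner_self)
qed (auto simp: scaleC_prod_def cinner_prod_def scaleC_of_real scaleC_add_right scaleC_add_left
    scaleC_scaleC cinner_add_left cinner_scaleC_left algebra_simps scaleR_prod_def)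

end

lemma fst_scaleC [simp]: "fst (c *\<^sub>C p) = c *\<^sub>C fst p"
  and snd_scaleC [simp]: "snd (c *\<^sub>C p) = c *\<^sub>C snd p"
  by (auto simp: scaleC_prod_def)

section \<open>The matrix algebra and the entrywise homomorphism\<close>

definition op_matrix :: "('a::chilbert_space \<Rightarrow>\<^sub>L 'a) \<Rightarrow> ('a \<Rightarrow>\<^sub>L 'a) \<Rightarrow> ('a \<Rightarrow>\<^sub>L 'a) \<Rightarrow> ('a \<Rightarrow>\<^sub>L 'a)
    \<Rightarrow> (('a \<times> 'a) \<Rightarrow>\<^sub>L ('a \<times> 'a))"
  where "op_matrix a b c d = Blinfun (\<lambda>p. (a (fst p) + b (snd p), c (fst p) + d (snd p)))"

lemma op_matrix_apply': "op_matrix a b c d p = (a (fst p) + b (snd p), c (fst p) + d (snd p))"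
proof -
  have "bounded_linear (\<lambda>p. (a (fst p) + b (snd p), c (fst p) + d (snd p)))"
    by (intro bounded_linear_Pair bounded_linear_add blinfun.bounded_linear_right
        bounded_linear_compose[OF blinfun.bounded_linear_right] bounded_linear_fst bounded_linear_snd)
  then show ?thesis by (simp add: op_matrix_def bounded_linear_Blinfun_apply)
qed

definition inl_blinfun :: "'a::real_normed_vector \<Rightarrow>\<^sub>L ('a \<times> 'a)" where "inl_blinfun = Blinfun (\<lambda>x. (x, 0))"
definition inr_blinfun :: "'a::real_normed_vector \<Rightarrow>\<^sub>L ('a \<times> 'a)" where "inr_blinfun = Blinfun (\<lambda>x. (0, x))"

lemma inl_blinfun_apply: "inl_blinfun x = (x, 0)"
  and inr_blinfun_apply: "inr_blinfun x = (0, x)"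
  unfolding inl_blinfun_def inr_blinfun_def
  by (subst bounded_linear_Blinfun_apply;
      intro bounded_linear_Pair bounded_linear_ident bounded_linear_zero refl)+

definition "ent11 X = fst_blinfun o\<^sub>L (X o\<^sub>L inl_blinfun)"
definition "ent12 X = fst_blinfun o\<^sub>L (X o\<^sub>L inr_blinfun)"
definition "ent21 X = snd_blinfun o\<^sub>L (X o\<^sub>L inl_blinfun)"
definition "ent22 X = snd_blinfun o\<^sub>L (X o\<^sub>L inr_blinfun)"

lemmas ent_defs = ent11_def ent12_def ent21_def ent22_def

lemma ent_apply:
  "ent11 X x = fst (X (x, 0))" "ent12 X x = fst (X (0, x))"
  "ent21 X x = snd (X (x, 0))" "ent22 X x = snd (X (0, x))"
  by (simp_all add: ent_defs inl_blinfun_apply inr_blinfun_apply)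

lemma op_matrix_apply [simp]: "op_matrix a b c d (x, y) = (a x + b y, c x + d y)"
  by (simp add: op_matrix_apply')

lemma op_matrix_eqI:
  fixes X Y :: "('a::real_normed_vector \<times> 'a) \<Rightarrow>\<^sub>L 'b::real_normed_vector"
  assumes "\<And>x y. X (x, y) = Y (x, y)" shows "X = Y"
  by (rule blinfun_eqI) (use assms in auto)

lemma ent_op_matrix [simp]:
  "ent11 (op_matrix a b c d) = a" "ent12 (op_matrix a b c d) = b"
  "ent21 (op_matrix a b c d) = c" "ent22 (op_matrix a b c d) = d"
  by (rule blinfun_eqI, simp add: ent_apply blinfun.zero_right)+

lemma apply_ent: "blinfun_apply X (x, y) = (ent11 X x + ent12 X y, ent21 X x + ent22 X y)"
  using blinfun.add_right[of X "(x, 0)" "(0, y)"] by (simp add: ent_apply prod_eq_iff)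

lemma op_matrix_ent: "op_matrix (ent11 X) (ent12 X) (ent21 X) (ent22 X) = X"
  by (rule op_matrix_eqI) (simp add: apply_ent[of X])

lemma op_matrix_add:
  "op_matrix a b c d + op_matrix a' b' c' d' = op_matrix (a + a') (b + b') (c + c') (d + d')"
  by (rule op_matrix_eqI) (simp add: blinfun.add_left)

lemma op_matrix_compose:
  "op_matrix a b c d o\<^sub>L op_matrix a' b' c' d'
    = op_matrix ((a o\<^sub>L a') + (b o\<^sub>L c')) ((a o\<^sub>L b') + (b o\<^sub>L d')) ((c o\<^sub>L a') + (d o\<^sub>L c')) ((c o\<^sub>L b') + (d o\<^sub>L d'))"
  by (rule op_matrix_eqI) (simp add: blinfun.add_left blinfun.add_right algebra_simps)

lemma op_matrix_scaleC:
  "op_scaleC k (op_matrix a b c d) = op_matrix (op_scaleC k a) (op_scaleC k b) (op_scaleC k c) (op_scaleC k d)"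
  by (rule op_matrix_eqI) (simp add: op_scaleC.rep_eq scaleC_prod_def scaleC_add_right)

lemma op_matrix_id: "op_matrix id_blinfun 0 0 id_blinfun = id_blinfun"
  by (rule op_matrix_eqI) simp

lemma op_matrix_bounded_ops:
  assumes "a \<in> bounded_ops" "b \<in> bounded_ops" "c \<in> bounded_ops" "d \<in> bounded_ops"
  shows "op_matrix a b c d \<in> bounded_ops"
  unfolding bounded_ops_def
  by (auto simp: op_matrix_apply' bounded_ops_scaleC[OF assms(1)] bounded_ops_scaleC[OF assms(2)]
      bounded_ops_scaleC[OF assms(3)] bounded_ops_scaleC[OF assms(4)] scaleC_prod_def scaleC_add_right)

lemma op_adj_matrix:
  assumes "a \<in> bounded_ops" "b \<in> bounded_ops" "c \<in> bounded_ops" "d \<in> bounded_ops"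
  shows "op_adj (op_matrix a b c d) = op_matrix (op_adj a) (op_adj c) (op_adj b) (op_adj d)"
  by (rule op_adj_unique)
    (auto simp: cinner_prod_def cinner_add_left cinner_add_right op_matrix_apply'
      cinner_op_adj[OF assms(1)] cinner_op_adj[OF assms(2)]
      cinner_op_adj[OF assms(3)] cinner_op_adj[OF assms(4)])

definition matrix_algebra :: "('a::chilbert_space \<Rightarrow>\<^sub>L 'a) set \<Rightarrow> (('a \<times> 'a) \<Rightarrow>\<^sub>L ('a \<times> 'a)) set"
  where "matrix_algebra M = {op_matrix a b c d | a b c d. a \<in> M \<and> b \<in> M \<and> c \<in> M \<and> d \<in> M}"

lemma op_matrix_mem_iff [simp]:
  "op_matrix a b c d \<in> matrix_algebra M \<longleftrightarrow> a \<in> M \<and> b \<in> M \<and> c \<in> M \<and> d \<in> M"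
  unfolding matrix_algebra_def by (auto dest: arg_cong[of _ _ ent11] arg_cong[of _ _ ent12]
    arg_cong[of _ _ ent21] arg_cong[of _ _ ent22])

lemma matrix_algebra_cases:
  assumes "X \<in> matrix_algebra M"
  obtains a b c d where "X = op_matrix a b c d" "a \<in> M" "b \<in> M" "c \<in> M" "d \<in> M"
  using assms unfolding matrix_algebra_def by blast

lemma matrix_algebra_iff_ent:
  "X \<in> matrix_algebra M \<longleftrightarrow> ent11 X \<in> M \<and> ent12 X \<in> M \<and> ent21 X \<in> M \<and> ent22 X \<in> M"
  by (subst op_matrix_ent[symmetric]) (simp only: op_matrix_mem_iff)

text \<open>For \<open>u\<close> in the commutant of \<open>M\<close>, the diagonal matrix with
  entries \<open>u\<close> and \<open>u\<close> commutes with all matrices over \<open>M\<close>. An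
  element of the double commutant commutes with it, which says that each of its entries commutes
  with \<open>u\<close>.\<close>

lemma (in vN_algebra) vN_matrix_algebra: "von_neumann_algebra (matrix_algebra M)"
  unfolding von_neumann_algebra_def
proof (intro conjI ballI equalityI subsetI)
  show "X \<in> bounded_ops" if "X \<in> matrix_algebra M" for X
    using that by (elim matrix_algebra_cases) (simp add: op_matrix_bounded_ops mem_bounded_ops)
  then show "X \<in> commutant (commutant (matrix_algebra M))" if "X \<in> matrix_algebra M" for X
    using that unfolding commutant_def by auto
  show "op_adj X \<in> matrix_algebra M" if "X \<in> matrix_algebra M" for X
    using that by (elim matrix_algebra_cases) (simp add: op_adj_matrix mem_bounded_ops adj_mem)
  fix X assume X: "X \<in> commutant (commutant (matrix_algebra M))"
  have diag: "op_matrix u 0 0 u \<in> commutant (matrix_algebra M)" if u: "u \<in> commutant M" for u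
    unfolding commutant_def
  proof (intro CollectI conjI ballI)
    show "op_matrix u 0 0 u \<in> bounded_ops"
      by (intro op_matrix_bounded_ops commutant_bounded_ops[OF u] mem_bounded_ops zero_mem)
    show "op_matrix u 0 0 u o\<^sub>L Y = Y o\<^sub>L op_matrix u 0 0 u" if "Y \<in> matrix_algebra M" for Y
      using that by (elim matrix_algebra_cases, hypsubst, intro op_matrix_eqI)
        (simp add: commutes[OF _ u] blinfun.add_right)
  qed
  have XB: "X \<in> bounded_ops" using X by (simp add: commutant_def)
  have comm: "X (u x, u y) = (u (fst (X (x, y))), u (snd (X (x, y))))" if u: "u \<in> commutant M" for u x y
  proof -
    have "X o\<^sub>L op_matrix u 0 0 u = op_matrix u 0 0 u o\<^sub>L X"
      using X diag[OF u] by (auto simp: commutant_def[of "commutant (matrix_algebra M)"])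
    then have "X (op_matrix u 0 0 u (x, y)) = op_matrix u 0 0 u (X (x, y))"
      by (metis blinfun_apply_blinfun_compose)
    then show ?thesis by (simp add: op_matrix_apply')
  qed
  have "X (c *\<^sub>C p) = c *\<^sub>C X p" for c p by (rule bounded_ops_scaleC[OF XB])
  then have lin: "X (c *\<^sub>C x, 0) = c *\<^sub>C X (x, 0)" "X (0, c *\<^sub>C x) = c *\<^sub>C X (0, x)" for c x
    by (metis scaleC_prod_def scaleC_zero_right fst_conv snd_conv)+
  have u0: "u 0 = 0" for u :: "'a \<Rightarrow>\<^sub>L 'a" by (rule blinfun.zero_right)
  show "X \<in> matrix_algebra M"
    unfolding matrix_algebra_iff_ent
    using comm[of _ _ 0] comm[of _ 0]
    by (intro conjI memI; simp add: bounded_ops_def ent_apply lin u0)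
qed

definition hom_matrix :: "(('a::chilbert_space \<Rightarrow>\<^sub>L 'a) \<Rightarrow> ('b::chilbert_space \<Rightarrow>\<^sub>L 'b))
    \<Rightarrow> (('a \<times> 'a) \<Rightarrow>\<^sub>L ('a \<times> 'a)) \<Rightarrow> (('b \<times> 'b) \<Rightarrow>\<^sub>L ('b \<times> 'b))"
  where "hom_matrix \<Phi> X = op_matrix (\<Phi> (ent11 X)) (\<Phi> (ent12 X)) (\<Phi> (ent21 X)) (\<Phi> (ent22 X))"

lemma hom_matrix_op_matrix [simp]:
  "hom_matrix \<Phi> (op_matrix a b c d) = op_matrix (\<Phi> a) (\<Phi> b) (\<Phi> c) (\<Phi> d)"
  by (simp add: hom_matrix_def)

lemma (in vN_hom) hom_matrix_star_hom:
  "unital_star_hom (matrix_algebra M) (matrix_algebra N) (hom_matrix \<Phi>)"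
  unfolding unital_star_hom_def
proof (intro conjI ballI allI)
  note simps = hom_add hom_compose hom_scaleC hom_adj hom_mem dom.mem_intros
  fix X assume "X \<in> matrix_algebra M"
  then obtain a b c d where X: "X = op_matrix a b c d" "a \<in> M" "b \<in> M" "c \<in> M" "d \<in> M"
    by (rule matrix_algebra_cases)
  show "hom_matrix \<Phi> X \<in> matrix_algebra N" by (simp add: X simps)
  show "hom_matrix \<Phi> (op_scaleC k X) = op_scaleC k (hom_matrix \<Phi> X)" for k
    by (simp add: X simps op_matrix_scaleC)
  show "hom_matrix \<Phi> (op_adj X) = op_adj (hom_matrix \<Phi> X)"
    by (simp add: X simps op_adj_matrix dom.mem_bounded_ops cod.mem_bounded_ops)
  fix Y assume "Y \<in> matrix_algebra M"
  then obtain a' b' c' d' where Y: "Y = op_matrix a' b' c' d'" "a' \<in> M" "b' \<in> M" "c' \<in> M" "d' \<in> M"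
    by (rule matrix_algebra_cases)
  show "hom_matrix \<Phi> (X + Y) = hom_matrix \<Phi> X + hom_matrix \<Phi> Y"
    by (simp add: X Y simps op_matrix_add)
  show "hom_matrix \<Phi> (X o\<^sub>L Y) = hom_matrix \<Phi> X o\<^sub>L hom_matrix \<Phi> Y"
    by (simp add: X Y simps op_matrix_compose)
next
  show "hom_matrix \<Phi> id_blinfun = id_blinfun"
    using hom_matrix_op_matrix[of \<Phi> id_blinfun 0 0 id_blinfun] by (simp add: op_matrix_id hom_id hom_zero)
qed

locale vN_normal_hom = vN_hom +
  assumes normal: "normal_map M N \<Phi>"

text \<open>Makes contractivity and the factorisation results available for matrices. Normality
  stays with \<Phi> on \<open>M\<close>; monotone limits of matrices are handled through
  compressions.\<close>

sublocale vN_normal_hom \<subseteq> mat: vN_hom "matrix_algebra M" "matrix_algebra N" "hom_matrix \<Phi>"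
  by unfold_locales (intro dom.vN_matrix_algebra cod.vN_matrix_algebra hom_matrix_star_hom)+


section \<open>Normal homomorphisms preserve null projections\<close>

text \<open>
  \<open>compression s t X\<close> is \<open>J\<^sup>* X J\<close> for the scalar column \<open>J x = (s x, t x)\<close>. The columns
  \<open>(1, 0)\<close>, \<open>(0, 1)\<close>, \<open>(1, 1)\<close> and \<open>(1, \<i>)\<close> recover all entries of \<open>X\<close>, which carries monotone
  limits of matrices over to monotone limits in the algebra itself.
\<close>

definition compression ::
    "complex \<Rightarrow> complex \<Rightarrow> (('a::chilbert_space \<times> 'a) \<Rightarrow>\<^sub>L ('a \<times> 'a)) \<Rightarrow> ('a \<Rightarrow>\<^sub>L 'a)"
  where "compression s t X =
    (op_scaleC (cnj s * s) (ent11 X) + op_scaleC (cnj s * t) (ent12 X))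
    + (op_scaleC (cnj t * s) (ent21 X) + op_scaleC (cnj t * t) (ent22 X))"

lemma cinner_compression:
  assumes "X \<in> bounded_ops"
  shows "cinner (compression s t X x) y = cinner (X (s *\<^sub>C x, t *\<^sub>C x)) (s *\<^sub>C y, t *\<^sub>C y)"
proof -
  have "X (c *\<^sub>C x, 0) = c *\<^sub>C X (x, 0)" "X (0, c *\<^sub>C x) = c *\<^sub>C X (0, x)" for c x
    using bounded_ops_scaleC[OF assms, of c "(x, 0)"] bounded_ops_scaleC[OF assms, of c "(0, x)"]
    by (simp_all add: scaleC_prod_def)
  then have "ent11 X (c *\<^sub>C x) = c *\<^sub>C ent11 X x" "ent12 X (c *\<^sub>C x) = c *\<^sub>C ent12 X x"
    "ent21 X (c *\<^sub>C x) = c *\<^sub>C ent21 X x" "ent22 X (c *\<^sub>C x) = c *\<^sub>C ent22 X x" for c x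
    by (simp_all add: ent_apply)
  then show ?thesis
    by (simp add: apply_ent[of X "s *\<^sub>C x" "t *\<^sub>C x"] compression_def blinfun.add_left
        op_scaleC.rep_eq cinner_prod_def cinner_simps algebra_simps)
qed

context vN_algebra
begin

interpretation mat: vN_algebra "matrix_algebra M"
  by unfold_locales (rule vN_matrix_algebra)

lemma compression_mem: "X \<in> matrix_algebra M \<Longrightarrow> compression s t X \<in> M"
  unfolding compression_def matrix_algebra_iff_ent by (intro mem_intros) auto

text \<open>The sign is there because the even powers decrease while normality speaks of
  suprema.\<close>

lemma compression_self_adjoint:
  assumes "X \<in> matrix_algebra M" "\<And>x y. cinner (X x) y = cinner x (X y)"
  shows "- compression s t X \<in> self_adjoint_part M"
proof -
  have X: "X \<in> bounded_ops" using assms(1) by (rule mat.mem_bounded_ops)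
  have "cinner (compression s t X x) y = cinner x (compression s t X y)" for x y
    using cinner_commute[of x "compression s t X y"]
      cinner_commute[of "X (s *\<^sub>C y, t *\<^sub>C y)" "(s *\<^sub>C x, t *\<^sub>C x)"]
    by (simp add: cinner_compression[OF X] assms(2))
  then have "op_adj (- compression s t X) = - compression s t X"
    by (intro op_adj_unique) (simp add: blinfun.minus_left cinner_minus_left cinner_minus_right)
  then show ?thesis
    by (simp add: self_adjoint_part_def uminus_mem compression_mem assms(1))
qed

text \<open>The quadratic form of the compressed power at \<open>x\<close> is the squared norm of
  \<open>K\<^sup>n\<close> applied to \<open>(s *\<^sub>C x, t *\<^sub>C x)\<close>. It decreases in
  \<open>n\<close>, so the negatives form a chain, and its limit is the form of the compressed
  limit.\<close>

lemma compression_power_limit_is_sup: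
  fixes s t :: complex
  assumes K: "self_adjoint_contraction K" "K \<in> matrix_algebra M"
  defines "D \<equiv> range (\<lambda>n. - compression s t (op_power (K o\<^sub>L K) n))"
  shows "D \<subseteq> self_adjoint_part M"
    and "\<forall>A\<in>D. \<forall>B\<in>D. \<exists>C\<in>D. op_le A C \<and> op_le B C"
    and "is_sup_in M D (- compression s t (power_limit K))"
proof -
  let ?v = "\<lambda>x :: 'a. (s *\<^sub>C x, t *\<^sub>C x)"
  define b where "b x n = (norm ((blinfun_apply K ^^ n) (?v x)))\<^sup>2" for x n
  have mem: "op_power (K o\<^sub>L K) n \<in> matrix_algebra M" for n
    by (intro mat.op_power_mem mat.compose_mem K)
  have lmem: "power_limit K \<in> matrix_algebra M"
    by (intro mat.power_limit_mem K)
  have form: "cinner (compression s t (op_power (K o\<^sub>L K) n) x) x = of_real (b x n)" for n x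
    by (simp add: cinner_compression mat.mem_bounded_ops[OF mem] quadratic_form_op_power[OF K(1)] b_def)
  have dec: "decseq (b x)" for x unfolding b_def by (rule decseq_norm_funpow[OF K(1)])
  have lim: "(\<lambda>n. complex_of_real (b x n)) \<longlonglongrightarrow> cinner (compression s t (power_limit K) x) x" for x
    unfolding form[symmetric] cinner_compression[OF mat.mem_bounded_ops[OF lmem]]
      cinner_compression[OF mat.mem_bounded_ops[OF mem]]
    by (intro tendsto_cinner op_power_tendsto[OF K(1)] tendsto_const)
  then have "(\<lambda>n. b x n) \<longlonglongrightarrow> Re (cinner (compression s t (power_limit K) x) x)" for x
    using tendsto_Re by fastforce
  then have ge: "Re (cinner (compression s t (power_limit K) x) x) \<le> b x n" for x n
    using decseq_ge[OF dec] by blast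
  \<comment> \<open>\<open>op_le\<close> asks for values in the nonnegative reals, so the limit form
    has to be known to be real before real parts can be compared.\<close>
  have re: "cinner (compression s t (power_limit K) x) x
      = of_real (Re (cinner (compression s t (power_limit K) x) x))" for x
  proof -
    have "(\<lambda>n. Im (complex_of_real (b x n))) \<longlonglongrightarrow> Im (cinner (compression s t (power_limit K) x) x)"
      by (intro tendsto_Im lim)
    then have "Im (cinner (compression s t (power_limit K) x) x) = 0"
      by (simp add: LIMSEQ_const_iff)
    then show ?thesis by (simp add: complex_eq_iff)
  qed
  have sa: "cinner (op_power (K o\<^sub>L K) n x) y = cinner x (op_power (K o\<^sub>L K) n y)" for n x y
    by (simp add: op_power_square[OF K(1)] cinner_funpow[OF K(1)])
  show D: "D \<subseteq> self_adjoint_part M"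
    unfolding D_def using compression_self_adjoint[OF mem sa] by auto
  have mono: "op_le (- compression s t (op_power (K o\<^sub>L K) n)) (- compression s t (op_power (K o\<^sub>L K) m))"
    if "n \<le> m" for n m
    unfolding op_le_def
  proof
    fix x
    have "cinner ((- compression s t (op_power (K o\<^sub>L K) m) - - compression s t (op_power (K o\<^sub>L K) n)) x) x
        = of_real (b x n - b x m)"
      by (simp add: blinfun.diff_left blinfun.minus_left cinner_simps form)
    also have "\<dots> \<in> \<real>\<^sub>\<ge>\<^sub>0" unfolding nonneg_Reals_of_real_iff using decseqD[OF dec that, of x] by simp
    finally show "cinner ((- compression s t (op_power (K o\<^sub>L K) m) - - compression s t (op_power (K o\<^sub>L K) n)) x) x \<in> \<real>\<^sub>\<ge>\<^sub>0" .
  qed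
  show "\<forall>A\<in>D. \<forall>B\<in>D. \<exists>C\<in>D. op_le A C \<and> op_le B C"
  proof (intro ballI)
    fix A B assume "A \<in> D" "B \<in> D"
    then obtain n m where "A = - compression s t (op_power (K o\<^sub>L K) n)"
      "B = - compression s t (op_power (K o\<^sub>L K) m)" unfolding D_def by blast
    then show "\<exists>C\<in>D. op_le A C \<and> op_le B C"
      unfolding D_def using mono[of n "max n m"] mono[of m "max n m"] by auto
  qed
  show "is_sup_in M D (- compression s t (power_limit K))"
    unfolding is_sup_in_def
  proof (intro conjI ballI impI)
    show "- compression s t (power_limit K) \<in> self_adjoint_part M"
      by (rule compression_self_adjoint[OF lmem cinner_power_limit[OF K(1)]])
    fix A assume "A \<in> D"
    then obtain n where A: "A = - compression s t (op_power (K o\<^sub>L K) n)" unfolding D_def by blast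
    show "op_le A (- compression s t (power_limit K))"
      unfolding op_le_def
    proof
      fix x
      have "cinner ((- compression s t (power_limit K) - A) x) x
          = of_real (b x n - Re (cinner (compression s t (power_limit K) x) x))"
        using re[of x] by (simp add: A blinfun.diff_left blinfun.minus_left cinner_simps form)
      also have "\<dots> \<in> \<real>\<^sub>\<ge>\<^sub>0" unfolding nonneg_Reals_of_real_iff using ge[of x n] by simp
      finally show "cinner ((- compression s t (power_limit K) - A) x) x \<in> \<real>\<^sub>\<ge>\<^sub>0" .
    qed
  next
    fix S assume le: "\<forall>A\<in>D. op_le A S"
    show "op_le (- compression s t (power_limit K)) S"
      unfolding op_le_def
    proof
      fix x
      have "cinner (S x) x + of_real (b x n) \<in> \<real>\<^sub>\<ge>\<^sub>0" for n
      proof -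
        have "op_le (- compression s t (op_power (K o\<^sub>L K) n)) S" using le by (simp add: D_def)
        then show ?thesis
          unfolding op_le_def
          by (auto dest!: spec[of _ x] simp: blinfun.diff_left blinfun.add_left cinner_simps form)
      qed
      \<comment> \<open>The bound passes to the limit because the nonnegative reals are closed in
        the complex plane.\<close>
      then have "cinner (S x) x + cinner (compression s t (power_limit K) x) x \<in> \<real>\<^sub>\<ge>\<^sub>0"
        by (rule closed_sequentially[OF closed_nonneg_Reals_complex _ tendsto_add[OF tendsto_const lim]])
      then show "cinner ((S - - compression s t (power_limit K)) x) x \<in> \<real>\<^sub>\<ge>\<^sub>0"
        by (simp add: blinfun.add_left cinner_simps)
    qed
  qed
qed

lemma op_le_antisym:
  assumes "A \<in> M" "B \<in> M" "op_le A B" "op_le B A" shows "A = B"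
proof (rule blinfun_eq_if_quadratic_form_eq)
  fix x
  define z where "z = cinner (A x) x - cinner (B x) x"
  have "z \<in> \<real>\<^sub>\<ge>\<^sub>0" "- z \<in> \<real>\<^sub>\<ge>\<^sub>0"
    using assms(3,4) by (auto simp: op_le_def z_def blinfun.diff_left cinner_diff_left)
  then have "z = 0" by (auto simp: complex_nonneg_Reals_iff complex_eq_iff)
  then show "cinner (A x) x = cinner (B x) x" by (simp add: z_def)
qed (use assms mem_bounded_ops in auto)

lemma is_sup_unique:
  assumes "is_sup_in M D S" "is_sup_in M D S'" shows "S = S'"
  using assms by (intro op_le_antisym) (auto simp: is_sup_in_def self_adjoint_part_def)

end

lemma eq_if_compressions_eq:
  assumes "\<And>s t. compression s t X = compression s t Y"
  shows "X = Y"
proof -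
  have eq: "cnj s *\<^sub>C s *\<^sub>C ent11 X x + cnj s *\<^sub>C t *\<^sub>C ent12 X x + (cnj t *\<^sub>C s *\<^sub>C ent21 X x + cnj t *\<^sub>C t *\<^sub>C ent22 X x)
      = cnj s *\<^sub>C s *\<^sub>C ent11 Y x + cnj s *\<^sub>C t *\<^sub>C ent12 Y x + (cnj t *\<^sub>C s *\<^sub>C ent21 Y x + cnj t *\<^sub>C t *\<^sub>C ent22 Y x)"
    for s t x
    using arg_cong[OF assms[of s t], of "\<lambda>T. blinfun_apply T x"]
    by (simp add: compression_def blinfun.add_left op_scaleC.rep_eq scaleC_scaleC)
  have c: "0 *\<^sub>C y = 0" "1 *\<^sub>C y = y" "(- 1) *\<^sub>C y = - y" for y :: 'a
    using scaleC_of_real[of 0 y] scaleC_of_real[of 1 y] scaleC_of_real[of "-1" y] by auto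
  have 11: "ent11 X x = ent11 Y x" for x using eq[of 1 x 0] by (simp add: c)
  have 22: "ent22 X x = ent22 Y x" for x using eq[of 0 x 1] by (simp add: c)
  have p: "ent12 X x + ent21 X x = ent12 Y x + ent21 Y x" for x
    using eq[of 1 x 1] by (simp add: c 11 22)
  \<comment> \<open>The column \<open>(1, \<i>)\<close> yields \<open>\<i>\<close> times the
    difference of the off-diagonal entries; the column \<open>(1, 1)\<close> gave their sum.\<close>
  have m: "ent12 X x - ent21 X x = ent12 Y x - ent21 Y x" for x
  proof -
    have "\<i> *\<^sub>C ent12 X x + (- \<i>) *\<^sub>C ent21 X x = \<i> *\<^sub>C ent12 Y x + (- \<i>) *\<^sub>C ent21 Y x"
      using eq[of 1 x \<i>] by (simp add: c 11 22 scaleC_scaleC)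
    then have "(- \<i>) *\<^sub>C (\<i> *\<^sub>C ent12 X x + (- \<i>) *\<^sub>C ent21 X x)
        = (- \<i>) *\<^sub>C (\<i> *\<^sub>C ent12 Y x + (- \<i>) *\<^sub>C ent21 Y x)" by simp
    then show ?thesis by (simp add: scaleC_add_right scaleC_scaleC c)
  qed
  have "2 *\<^sub>R ent12 X x = 2 *\<^sub>R ent12 Y x" for x
    using arg_cong2[OF p[of x] m[of x], of "(+)"] by (simp add: scaleR_2 algebra_simps)
  then have 12: "ent12 X x = ent12 Y x" for x by simp
  have 21: "ent21 X x = ent21 Y x" for x using p[of x] 12[of x] by simp
  show ?thesis
    by (rule op_matrix_eqI) (simp add: apply_ent[of X] apply_ent[of Y] 11 12 21 22)
qed

section \<open>Transport of null projections and of inclusions along \<Phi>\<close>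

context vN_normal_hom
begin

lemma hom_compression:
  assumes "X \<in> matrix_algebra M"
  shows "\<Phi> (compression s t X) = compression s t (hom_matrix \<Phi> X)"
  using assms unfolding compression_def matrix_algebra_iff_ent
  by (simp add: hom_add hom_scaleC dom.mem_intros hom_matrix_def)

lemma hom_op_power: "X \<in> matrix_algebra M \<Longrightarrow> hom_matrix \<Phi> (op_power X n) = op_power (hom_matrix \<Phi> X) n"
  by (induction n) (simp_all add: mat.hom_id mat.hom_compose mat.dom.op_power_mem)

text \<open>The negated compressions of both sides are suprema in \<open>N\<close> of the same set:
  on the left by normality of \<Phi>, on the right by monotone convergence in
  \<open>N\<close>.\<close>

lemma hom_power_limit:
  assumes K: "self_adjoint_contraction K" "K \<in> matrix_algebra M"
    and K': "self_adjoint_contraction (hom_matrix \<Phi> K)"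
  shows "hom_matrix \<Phi> (power_limit K) = power_limit (hom_matrix \<Phi> K)"
proof (rule eq_if_compressions_eq)
  fix s t
  let ?K' = "hom_matrix \<Phi> K"
  let ?D = "range (\<lambda>n. - compression s t (op_power (K o\<^sub>L K) n))"
  have KN: "?K' \<in> matrix_algebra N" using K(2) by (rule mat.hom_mem)
  have lmem: "power_limit K \<in> matrix_algebra M" by (rule mat.dom.power_limit_mem[OF K])
  have "\<Phi> (- compression s t (op_power (K o\<^sub>L K) n)) = - compression s t (op_power (?K' o\<^sub>L ?K') n)" for n
    using K(2) by (simp add: hom_uminus hom_compression hom_op_power mat.hom_compose
        dom.compression_mem mat.dom.op_power_mem mat.dom.compose_mem)
  then have img: "\<Phi> ` ?D = range (\<lambda>n. - compression s t (op_power (?K' o\<^sub>L ?K') n))"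
    by (auto simp: image_image)
  have "is_sup_in N (\<Phi> ` ?D) (\<Phi> (- compression s t (power_limit K)))"
    using normal[unfolded normal_map_def, rule_format, of ?D "- compression s t (power_limit K)"]
      dom.compression_power_limit_is_sup[OF K, of s t] by simp
  moreover have "is_sup_in N (\<Phi> ` ?D) (- compression s t (power_limit ?K'))"
    unfolding img by (rule cod.compression_power_limit_is_sup(3)[OF K' KN])
  ultimately have "\<Phi> (- compression s t (power_limit K)) = - compression s t (power_limit ?K')"
    by (rule cod.is_sup_unique)
  then show "compression s t (hom_matrix \<Phi> (power_limit K)) = compression s t (power_limit ?K')"
    by (simp add: hom_uminus dom.compression_mem lmem hom_compression)
qed

text \<open>Contractivity makes the constant of \<open>B\<close> admissible for the image. The limit
  obtained may use another constant than \<open>null_proj\<close> of the image does, and uniqueness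
  of null projections bridges the difference.\<close>

lemma hom_null_proj:
  assumes B: "B \<in> matrix_algebra M"
  shows "hom_matrix \<Phi> (null_proj B) = null_proj (hom_matrix \<Phi> B)"
proof -
  define c where "c = (norm B)\<^sup>2 + 1"
  let ?B' = "hom_matrix \<Phi> B"
  have BN: "?B' \<in> bounded_ops" using mat.hom_mem[OF B] by (rule mat.cod.mem_bounded_ops)
  have "(norm ?B')\<^sup>2 \<le> (norm B)\<^sup>2" by (intro power_mono mat.hom_contractive B) simp
  moreover have "c > (norm B)\<^sup>2" by (simp add: c_def)
  ultimately have c: "c > 0" "(norm ?B')\<^sup>2 \<le> c"
    using zero_le_power2[of "norm B"] by linarith+
  note K' = defect_self_adjoint_contraction[OF BN c]
  have hd: "hom_matrix \<Phi> (defect c B) = defect c ?B'"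
    unfolding defect_def using B
    by (simp add: mat.hom_diff mat.hom_id mat.hom_scaleR mat.hom_compose mat.hom_adj mat.dom.mem_intros)
  have "hom_matrix \<Phi> (null_proj B) = power_limit (defect c ?B')"
    using hom_power_limit[OF null_proj_defect[OF mat.dom.mem_bounded_ops[OF B]]
        mat.dom.defect_mem[OF B]] K'
    by (simp add: null_proj_def hd flip: c_def)
  also have "\<dots> = null_proj ?B'"
  proof (rule null_proj_unique[OF BN])
    show "power_limit (defect c ?B') \<in> bounded_ops"
      by (intro mat.cod.mem_bounded_ops mat.cod.power_limit_mem K' mat.cod.defect_mem mat.hom_mem B)
  qed (simp_all add: op_adj_power_limit[OF K'] power_limit_idem[OF K'] power_limit_fixed_iff[OF K']
      defect_defect_eq_iff[OF BN c])
  finally show ?thesis .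
qed

text \<open>The inclusion of null spaces is the identity \<open>A P = 0\<close> with
  \<open>P = null_proj B\<close>, and the image of \<open>P\<close> is the null projection of the
  image.\<close>

lemma hom_null_mono:
  assumes A: "A \<in> matrix_algebra M" and B: "B \<in> matrix_algebra M"
    and sub: "\<And>x. B x = 0 \<Longrightarrow> A x = 0" and x: "hom_matrix \<Phi> B x = 0"
  shows "hom_matrix \<Phi> A x = 0"
proof -
  have "A o\<^sub>L null_proj B = 0"
    by (rule blinfun_eqI) (simp add: sub mat.dom.mem_bounded_ops[OF B])
  then have "hom_matrix \<Phi> A o\<^sub>L null_proj (hom_matrix \<Phi> B) = 0"
    using mat.hom_compose[OF A mat.dom.null_proj_mem[OF B]] by (simp add: hom_null_proj[OF B] mat.hom_zero)
  then have "hom_matrix \<Phi> A (null_proj (hom_matrix \<Phi> B) x) = 0"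
    by (metis blinfun_apply_blinfun_compose zero_blinfun.rep_eq)
  then show ?thesis
    using null_proj_eq_iff[OF mat.cod.mem_bounded_ops[OF mat.hom_mem[OF B]]] x by metis
qed

lemma hom_range_mono:
  assumes A: "A \<in> matrix_algebra M" and B: "B \<in> matrix_algebra M"
    and sub: "range (blinfun_apply A) \<subseteq> range (blinfun_apply B)"
  shows "range (blinfun_apply (hom_matrix \<Phi> A)) \<subseteq> range (blinfun_apply (hom_matrix \<Phi> B))"
proof -
  obtain X where "X \<in> matrix_algebra M" "A = B o\<^sub>L X"
    using mat.dom.range_subset_imp_factor[OF A B sub] by blast
  then show ?thesis using mat.hom_compose[OF B] by auto
qed

end


section \<open>Operators with a matrix range as graph\<close>

text \<open>With \<open>Q = null_proj (op_adj V)\<close> one has \<open>Q V = 0\<close>, so the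
  closed null space of \<open>Q\<close>, which is the range of \<open>E\<close>, contains the range
  of \<open>V\<close>. Density comes from the power identity: \<open>x\<close> minus a power applied
  to \<open>x\<close> lies in the range of \<open>V\<close> and tends to \<open>E x\<close>.\<close>

lemma (in vN_algebra) closure_range:
  assumes V: "V \<in> M"
  defines "E \<equiv> id_blinfun - null_proj (op_adj V)"
  shows "E \<in> M" "op_adj E = E" "E (E x) = E x" "range (blinfun_apply E) = closure (range (blinfun_apply V))"
proof -
  let ?Q = "null_proj (op_adj V)"
  note V' = adj_mem[OF V]
  note Vb = mem_bounded_ops[OF V']
  have Q: "?Q \<in> M" by (rule null_proj_mem[OF V'])
  have E_apply: "E x = x - ?Q x" for x by (simp add: E_def blinfun.diff_left)
  have Q_adj: "cinner (?Q x) y = cinner x (?Q y)" for x y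
    by (simp add: cinner_adj[OF Q] op_adj_null_proj[OF Vb])
  show "E \<in> M" unfolding E_def by (intro mem_intros Q)
  show "op_adj E = E"
    by (rule op_adj_unique) (simp add: E_apply cinner_diff_left cinner_diff_right Q_adj)
  show "E (E x) = E x" for x
    by (simp add: E_apply blinfun.diff_right null_proj_idem[OF Vb])
  have range_E: "range (blinfun_apply E) = {x. ?Q x = 0}"
  proof (intro equalityI subsetI)
    show "x \<in> {x. ?Q x = 0}" if "x \<in> range (blinfun_apply E)" for x
      using that by (auto simp: E_apply blinfun.diff_right null_proj_idem[OF Vb])
    show "x \<in> range (blinfun_apply E)" if "x \<in> {x. ?Q x = 0}" for x
      using that by (auto simp: E_apply intro!: range_eqI[of x _ x])
  qed
  show "range (blinfun_apply E) = closure (range (blinfun_apply V))"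
  proof (rule equalityI)
    have "?Q (V y) = 0" for y
    proof (rule cinner_ext_left)
      show "cinner (?Q (V y)) z = cinner 0 z" for z
        by (simp add: Q_adj cinner_adj[OF V] op_null_proj[OF Vb])
    qed
    moreover have "closed {x. ?Q x = 0}"
      by (intro closed_Collect_eq continuous_intros)
    ultimately show "closure (range (blinfun_apply V)) \<subseteq> range (blinfun_apply E)"
      unfolding range_E by (intro closure_minimal) auto
    define c where "c = (norm (op_adj V))\<^sup>2 + 1"
    have "c > 0" by (auto simp: c_def intro: add_nonneg_pos)
    define K where "K = defect c (op_adj V)"
    have K: "self_adjoint_contraction K" unfolding K_def c_def by (rule null_proj_defect[OF Vb])
    have "x - op_power (K o\<^sub>L K) n x \<in> range (blinfun_apply V)" for n x
    proof -
      obtain G where "(1 / c) *\<^sub>R V (G (op_adj V x)) = x - op_power (K o\<^sub>L K) n x"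
        using defect_power_factors[OF V \<open>c > 0\<close>, of n] unfolding K_def by blast
      then show ?thesis by (metis blinfun.scaleR_right rangeI)
    qed
    moreover have "(\<lambda>n. x - op_power (K o\<^sub>L K) n x) \<longlonglongrightarrow> E x" for x
      unfolding E_apply null_proj_def c_def[symmetric] K_def[symmetric]
      by (intro tendsto_diff tendsto_const op_power_tendsto K)
    ultimately show "range (blinfun_apply E) \<subseteq> closure (range (blinfun_apply V))"
      by (force simp: closure_sequential)
  qed
qed

lemma graph_eq_iff: "Map.graph S = Map.graph T \<longleftrightarrow> S = T"
proof
  assume eq: "Map.graph S = Map.graph T"
  have "S x = Some y \<longleftrightarrow> T x = Some y" for x y
    using eq by (metis in_graphD in_graphI)
  then show "S = T" by (metis ext not_Some_eq)
qed simp

lemma graph_dom: "x \<in> dom T \<Longrightarrow> (x, the (T x)) \<in> Map.graph T"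
  by (auto intro: in_graphI)

lemma unbounded_op_if_graph_range:
  fixes V :: "('a::chilbert_space \<times> 'a) \<Rightarrow>\<^sub>L ('a \<times> 'a)"
  assumes V: "V \<in> bounded_ops" and T: "Map.graph T = range (blinfun_apply V)"
  shows "unbounded_op T"
  unfolding unbounded_op_def
proof (intro conjI ballI allI)
  have "V 0 = (0, 0)" using blinfun.zero_right[of V] unfolding zero_prod_def .
  then have "(0, 0) \<in> Map.graph T" unfolding T by (metis rangeI)
  then show "0 \<in> dom T" by (auto dest: in_graphD)
  show "x + y \<in> dom T" "the (T (x + y)) = the (T x) + the (T y)" if xy: "x \<in> dom T" "y \<in> dom T" for x y
  proof -
    obtain p q where "(x, the (T x)) = V p" "(y, the (T y)) = V q"
      using graph_dom[OF xy(1)] graph_dom[OF xy(2)] unfolding T by blast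
    then have "V (p + q) = (x + y, the (T x) + the (T y))" by (metis blinfun.add_right add_Pair)
    then have "T (x + y) = Some (the (T x) + the (T y))"
      by (intro in_graphD) (simp add: T range_eqI[of _ _ "p + q"])
    then show "x + y \<in> dom T" "the (T (x + y)) = the (T x) + the (T y)" by auto
  qed
  show "c *\<^sub>C x \<in> dom T" "the (T (c *\<^sub>C x)) = c *\<^sub>C the (T x)" if x: "x \<in> dom T" for c x
  proof -
    obtain p where "(x, the (T x)) = V p" using graph_dom[OF x] unfolding T by blast
    then have "V (c *\<^sub>C p) = (c *\<^sub>C x, c *\<^sub>C the (T x))"
      by (metis bounded_ops_scaleC[OF V] scaleC_prod_def fst_conv snd_conv)
    then have "T (c *\<^sub>C x) = Some (c *\<^sub>C the (T x))"
      by (intro in_graphD) (simp add: T range_eqI[of _ _ "c *\<^sub>C p"])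
    then show "c *\<^sub>C x \<in> dom T" "the (T (c *\<^sub>C x)) = c *\<^sub>C the (T x)" by auto
  qed
qed

lemma graph_exists_if_no_vertical:
  fixes V :: "('a::real_normed_vector \<times> 'a) \<Rightarrow>\<^sub>L ('a \<times> 'a)"
  assumes "\<And>y. (0, y) \<in> range (blinfun_apply V) \<Longrightarrow> y = 0"
  obtains T where "Map.graph T = range (blinfun_apply V)"
proof -
  have single: "y = z" if yz: "(x, y) \<in> range (blinfun_apply V)" "(x, z) \<in> range (blinfun_apply V)" for x y z
  proof -
    obtain p q where "V p = (x, y)" "V q = (x, z)" using yz by auto
    then have "V (p - q) = (0, y - z)" by (simp add: blinfun.diff_right)
    then have "y - z = 0" by (intro assms range_eqI[of _ _ "p - q"]) simp
    then show ?thesis by simp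
  qed
  define T where "T x = (if \<exists>y. (x, y) \<in> range (blinfun_apply V)
    then Some (SOME y. (x, y) \<in> range (blinfun_apply V)) else None)" for x
  have "T x = Some y \<longleftrightarrow> (x, y) \<in> range (blinfun_apply V)" for x y
  proof (cases "\<exists>z. (x, z) \<in> range (blinfun_apply V)")
    case True
    then have "(x, SOME z. (x, z) \<in> range (blinfun_apply V)) \<in> range (blinfun_apply V)"
      by (rule someI_ex)
    then show ?thesis using True single by (simp only: T_def if_True option.inject) blast
  qed (simp only: T_def if_False option.distinct, blast)
  then have "p \<in> Map.graph T \<longleftrightarrow> p \<in> range (blinfun_apply V)" for p
    by (cases p) (simp add: Map.graph_def)
  then show ?thesis by (intro that[of T] set_eqI)
qed

lemma no_vertical_if_graph:
  assumes "unbounded_op T" "(0, y) \<in> Map.graph T" shows "y = 0"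
proof -
  have "T 0 = Some y" using assms(2) by (rule in_graphD)
  moreover have "the (T (0 + 0)) = the (T 0) + the (T 0)"
    using assms(1) unfolding unbounded_op_def by blast
  ultimately show ?thesis by simp
qed

lemma graph_op_closure:
  assumes "preclosed_op T"
  shows "Map.graph (op_closure T) = closure (Map.graph T)" "unbounded_op (op_closure T)"
proof -
  obtain S where S: "unbounded_op S" "Map.graph S = closure (Map.graph T)"
    using assms unfolding preclosed_op_def by blast
  then have "op_closure T = S"
    unfolding op_closure_def by (intro the_equality) (auto simp: graph_eq_iff[symmetric])
  then show "Map.graph (op_closure T) = closure (Map.graph T)" "unbounded_op (op_closure T)"
    using S by auto
qed

lemma closed_imp_preclosed: "closed_op T \<Longrightarrow> preclosed_op T"
  unfolding closed_op_def preclosed_op_def by (metis closure_closed)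

lemma op_closure_closed:
  assumes "closed_op T" shows "op_closure T = T"
  using graph_op_closure(1)[OF closed_imp_preclosed[OF assms]] assms
  by (simp add: closed_op_def graph_eq_iff)

lemma closed_op_closure: "preclosed_op T \<Longrightarrow> closed_op (op_closure T)"
  by (simp add: closed_op_def graph_op_closure)

section \<open>Graphs of quotients, of their sums and of their products\<close>

lemma graph_quot:
  assumes "null_space B \<subseteq> null_space A"
  shows "Map.graph (quot A B) = {(B x, A x) | x. True}"
proof -
  have eq: "(THE z. \<exists>x'. B x = B x' \<and> z = A x') = A x" for x
  proof (rule the_equality)
    fix z assume "\<exists>x'. B x = B x' \<and> z = A x'"
    then obtain x' where x': "B x = B x'" "z = A x'" by blast
    then have "x' - x \<in> null_space B" by (simp add: null_space_def blinfun.diff_right)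
    then have "x' - x \<in> null_space A" using assms by blast
    then show "z = A x" by (simp add: null_space_def blinfun.diff_right x')
  qed blast
  show ?thesis unfolding Map.graph_def quot_def by (auto simp: eq split: if_splits) blast
qed

lemma graph_quot_range:
  assumes "null_space B \<subseteq> null_space A"
  shows "Map.graph (quot A B) = range (blinfun_apply (op_matrix B 0 A 0))"
  unfolding graph_quot[OF assms] by (auto simp: op_matrix_apply' image_iff)

lemma range_compose_null_proj:
  assumes "X \<in> bounded_ops"
  shows "range (blinfun_apply (V o\<^sub>L null_proj X)) = {V p | p. X p = 0}"
  using null_proj_eq_iff[OF assms] op_null_proj[OF assms] by (auto simp: image_iff) metis

lemma graph_op_sum: "Map.graph (op_sum S T) = {(x, y + z) | x y z. (x, y) \<in> Map.graph S \<and> (x, z) \<in> Map.graph T}"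
  by (auto simp: Map.graph_def op_sum_def split: if_splits)

text \<open>A common domain point is \<open>B x = D y\<close>, that is, \<open>(x, y)\<close> is
  annihilated by the row \<open>(B, - D)\<close>; the graph point is then
  \<open>(B x, A x + C y)\<close>.\<close>

lemma graph_sum_quot:
  assumes AB: "null_space B \<subseteq> null_space A" and CD: "null_space D \<subseteq> null_space C"
    and X: "op_matrix B (- D) 0 0 \<in> bounded_ops"
  shows "Map.graph (op_sum (quot A B) (quot C D))
    = range (blinfun_apply (op_matrix B 0 A C o\<^sub>L null_proj (op_matrix B (- D) 0 0)))"
  unfolding range_compose_null_proj[OF X] graph_op_sum graph_quot[OF AB] graph_quot[OF CD]
  by (auto simp: blinfun.minus_left op_matrix_apply' zero_prod_def)

text \<open>The product is defined at \<open>D y\<close> when \<open>C y = B x\<close> for some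
  \<open>x\<close>, that is, \<open>(x, y)\<close> is annihilated by the row
  \<open>(B, - C)\<close>; its value there is \<open>A x\<close>.\<close>

lemma graph_prod_quot:
  assumes AB: "null_space B \<subseteq> null_space A" and CD: "null_space D \<subseteq> null_space C"
    and X: "op_matrix B (- C) 0 0 \<in> bounded_ops"
  shows "Map.graph (quot A B \<circ>\<^sub>m quot C D)
    = range (blinfun_apply (op_matrix 0 D A 0 o\<^sub>L null_proj (op_matrix B (- C) 0 0)))"
  unfolding range_compose_null_proj[OF X] graph_map_comp graph_quot[OF AB] graph_quot[OF CD]
  by (auto simp: blinfun.minus_left op_matrix_apply' relcomp_unfold zero_prod_def) fastforce+

text \<open>The squared norm of \<open>E (0, y)\<close> is \<open>cinner (ent22 E y) y\<close>, here
  the squared norm of \<open>y\<close>. The second component \<open>y\<close> already accounts for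
  all of it, so the first one vanishes.\<close>

lemma projection_vertical:
  assumes E: "E \<in> bounded_ops" "op_adj E = E" "\<And>p. E (E p) = E p" and y: "ent22 E y = y"
  shows "E (0, y) = (0, y)"
proof -
  have sa: "cinner (E p) q = cinner p (E q)" for p q using cinner_op_adj[OF E(1)] E(2) by simp
  have "cinner (E (0, y)) (E (0, y)) = cinner (E (0, y)) (0, y)" by (simp add: sa E(3))
  also have "\<dots> = cinner y y" using y by (simp add: cinner_prod_def ent_apply)
  finally have "cinner (fst (E (0, y))) (fst (E (0, y))) = 0"
    using y by (simp add: cinner_prod_def ent_apply)
  then show ?thesis using y by (simp add: cinner_self prod_eq_iff ent_apply)
qed

text \<open>
  Write \<open>e11 = R\<^sup>2\<close> and \<open>e21 = A R\<close>. Then \<open>E = W W\<^sup>*\<close> for the column \<open>W = (R, A)\<close>: the identity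
  \<open>A A\<^sup>* = e22\<close> holds after multiplication by \<open>1 - e22\<close>, which is injective because the range of
  \<open>E\<close> contains no vertical vector.
\<close>

lemma (in vN_algebra) projection_range_is_quot_graph:
  assumes E: "E \<in> matrix_algebra M" "op_adj E = E" "\<And>p. E (E p) = E p"
    and vert: "\<And>y. (0, y) \<in> range (blinfun_apply E) \<Longrightarrow> y = 0"
  obtains A R where "A \<in> M" "R \<in> M" "null_space R \<subseteq> null_space A"
    "Map.graph (quot A R) = range (blinfun_apply E)"
proof -
  obtain e11 e12 e21 e22 where Em: "E = op_matrix e11 e12 e21 e22"
    and e: "e11 \<in> M" "e12 \<in> M" "e21 \<in> M" "e22 \<in> M"
    using E(1) by (rule matrix_algebra_cases)
  have Eb: "E \<in> bounded_ops"
    unfolding Em by (intro op_matrix_bounded_ops mem_bounded_ops e)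
  have sa: "cinner (E p) q = cinner p (E q)" for p q using cinner_op_adj[OF Eb] E(2) by simp
  have form: "cinner (E p) p = of_real ((norm (E p))\<^sup>2)" for p
    using sa[of "E p" p] by (simp add: E(3) cinner_self)
  have adj: "op_adj e11 = e11" "op_adj e21 = e12"
    using arg_cong[OF E(2), of ent11] arg_cong[OF E(2), of ent12]
    by (simp_all add: Em op_adj_matrix e mem_bounded_ops)
  have mult: "e21 (e11 x) + e22 (e21 x) = e21 x" "e21 (e12 x) + e22 (e22 x) = e22 x" for x
    using E(3)[of "(x, 0)"] E(3)[of "(0, x)"] by (simp_all add: Em blinfun.zero_right)
  have "norm ((id_blinfun - e11) x) \<le> 1 * norm x" for x
  proof -
    let ?p = "(x, 0 :: 'a)"
    have "(norm ((id_blinfun - e11) x))\<^sup>2 \<le> (norm (?p - E ?p))\<^sup>2"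
      by (simp add: Em blinfun.diff_left blinfun.zero_right norm_prod_def)
    also have "\<dots> \<le> (norm ?p)\<^sup>2"
      using form[of ?p] Re_cinner_commute[of ?p "E ?p"] by (simp add: norm_diff_sq)
    finally show ?thesis by (simp add: norm_prod_def)
  qed
  then have "norm (id_blinfun - e11) \<le> 1" by (intro norm_blinfun_bound) auto
  moreover have "op_adj (id_blinfun - e11) = id_blinfun - e11"
    by (rule op_adj_unique)
      (simp add: blinfun.diff_left cinner_diff_left cinner_diff_right cinner_adj[OF e(1)] adj)
  ultimately obtain R where R: "R \<in> M" "op_adj R = R"
    and RR: "id_blinfun - (id_blinfun - e11) = R o\<^sub>L R"
    using square_root_exists[OF diff_mem[OF id_mem e(1)]] by blast
  have e11: "e11 x = R (R x)" for x
    using arg_cong[OF RR, of "\<lambda>T. blinfun_apply T x"] by simp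
  have R_sa: "cinner (R x) y = cinner x (R y)" for x y using cinner_adj[OF R(1)] R(2) by simp
  have "norm (e21 x) \<le> 1 * norm (R x)" for x
  proof (rule power2_le_imp_le)
    have "(norm (R x))\<^sup>2 = Re (cinner (E (x, 0)) (x, 0))"
      by (simp add: Em cinner_prod_def e11 R_sa blinfun.zero_right) (simp add: cinner_self flip: R_sa)
    also have "\<dots> = (norm (e11 x))\<^sup>2 + (norm (e21 x))\<^sup>2"
      unfolding form by (simp add: Em norm_prod_def blinfun.zero_right)
    finally show "(norm (e21 x))\<^sup>2 \<le> (1 * norm (R x))\<^sup>2" by simp
  qed simp
  then obtain Z where Z: "Z \<in> M" "e21 = Z o\<^sub>L R"
    using Douglas_factorization[OF e(3) R(1), of 1] by auto
  define P where "P = null_proj R"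
  note Rb = mem_bounded_ops[OF R(1)]
  have P: "P \<in> M" "op_adj P = P" unfolding P_def by (rule null_proj_mem[OF R(1)], rule op_adj_null_proj[OF Rb])
  have PR: "P (R x) = 0" for x
  proof (rule cinner_ext_left)
    show "cinner (P (R x)) z = cinner 0 z" for z
      using op_null_proj[OF Rb] by (simp add: cinner_adj[OF P(1)] P(2) R_sa) (simp add: P_def)
  qed
  \<comment> \<open>\<open>Z\<close> matters only on the range of \<open>R\<close>; cutting it off
    on the null space of \<open>R\<close> gives the inclusion required of a quotient.\<close>
  define A where "A = Z o\<^sub>L (id_blinfun - P)"
  have A: "A \<in> M" unfolding A_def by (intro mem_intros Z P)
  have AR: "e21 x = A (R x)" for x by (simp add: A_def Z(2) blinfun.diff_left PR)
  have AP: "A (P x) = 0" for x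
    by (simp add: A_def blinfun.diff_left blinfun.zero_right P_def null_proj_idem[OF Rb])
  have RA: "e12 x = R (op_adj A x)" for x
  proof -
    have "e21 = A o\<^sub>L R" by (rule blinfun_eqI) (simp add: AR)
    then have "e12 = R o\<^sub>L op_adj A" using adj(2) by (simp add: adj_compose A R)
    then show ?thesis by simp
  qed
  have null: "null_space R \<subseteq> null_space A"
  proof
    fix x assume "x \<in> null_space R"
    then have "P x = x" unfolding P_def by (simp add: null_proj_eq_iff[OF Rb] null_space_def)
    then show "x \<in> null_space A" using AP[of x] by (simp add: null_space_def)
  qed
  \<comment> \<open>This is \<open>(1 - e22) A - A e11\<close>. It vanishes on the range of
    \<open>R\<close>, by the lower row of \<open>E E = E\<close>, and on the null space of
    \<open>R\<close>; together these span a dense subspace because \<open>R\<close> is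
    self-adjoint.\<close>
  define X where "X = A - (e22 o\<^sub>L A) - (A o\<^sub>L (R o\<^sub>L R))"
  have X: "X \<in> M" unfolding X_def by (intro mem_intros A e R)
  have XR: "X (R x) = 0" for x
  proof -
    have "X (R x) = e21 x - e22 (e21 x) - e21 (e11 x)" by (simp add: X_def blinfun.diff_left AR e11)
    then show ?thesis using mult(1)[of x] by (simp add: algebra_simps)
  qed
  have XP: "X (P x) = 0" for x
    using op_null_proj[OF Rb]
    by (simp add: X_def blinfun.diff_left AP blinfun.zero_right) (simp add: P_def blinfun.zero_right)
  have X0: "X x = 0" for x
  proof (rule cinner_ext_left)
    fix z
    have "R (op_adj X z) = 0"
    proof (rule cinner_ext)
      show "cinner w (R (op_adj X z)) = cinner w 0" for w
        by (simp add: XR flip: R_sa cinner_adj[OF X])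
    qed
    then have "P (op_adj X z) = op_adj X z" unfolding P_def by (simp add: null_proj_eq_iff[OF Rb])
    then have "cinner (X x) z = cinner (X (P x)) z"
      by (simp add: cinner_adj[OF X] cinner_adj[OF P(1)] P(2))
    then show "cinner (X x) z = cinner 0 z" by (simp add: XP)
  qed
  \<comment> \<open>Evaluating the vanishing \<open>X\<close> at \<open>op_adj A z\<close> gives
    \<open>(1 - e22) w = 0\<close> for the difference \<open>w\<close> of the two sides.\<close>
  have AA: "A (op_adj A z) = e22 z" for z
  proof -
    define w where "w = A (op_adj A z) - e22 z"
    have "A (op_adj A z) - e22 (A (op_adj A z)) = e21 (e12 z)"
      using X0[of "op_adj A z"] by (simp add: X_def blinfun.diff_left AR RA)
    also have "\<dots> = e22 z - e22 (e22 z)" using mult(2)[of z] by (simp add: eq_diff_eq)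
    finally have "ent22 E w = w" by (simp add: w_def Em blinfun.diff_right algebra_simps)
    then have "E (0, w) = (0, w)" by (rule projection_vertical[OF Eb E(2,3)])
    then have "w = 0" by (intro vert range_eqI[of _ _ "(0, w)"]) simp
    then show ?thesis by (simp add: w_def)
  qed
  define W where "W = op_matrix R 0 A 0"
  have W_adj: "op_adj W = op_matrix R (op_adj A) 0 0"
    unfolding W_def
    by (subst op_adj_matrix)
      (auto simp: mem_bounded_ops A R zero_mem op_adj_unique[of 0 0])
  have Wb: "W \<in> bounded_ops"
    unfolding W_def by (intro op_matrix_bounded_ops mem_bounded_ops A R zero_mem)
  have WW: "W (op_adj W p) = E p" for p
    unfolding W_adj Em by (cases p) (simp add: W_def e11 RA AR AA blinfun.add_right)
  \<comment> \<open>\<open>W W\<^sup>* = E\<close> puts the range of \<open>E\<close> into that of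
    \<open>W\<close>. For the converse, \<open>q\<close> is orthogonal to both \<open>W p\<close>
    and \<open>E (W p)\<close>, hence to itself.\<close>
  have EW: "E (W p) = W p" for p
  proof -
    define q where "q = W p - E (W p)"
    have Eq: "E q = 0" by (simp add: q_def blinfun.diff_right E(3))
    have "cinner (op_adj W q) (op_adj W q) = cinner (E q) q"
      unfolding WW[symmetric] by (rule cinner_op_adj[OF Wb, symmetric])
    then have "op_adj W q = 0" by (simp add: Eq cinner_self)
    then have "cinner (W p) q = 0" by (simp add: cinner_op_adj[OF Wb])
    moreover have "cinner (E (W p)) q = 0" by (simp add: sa Eq)
    ultimately have "cinner q q = 0" by (subst q_def) (simp add: cinner_diff_left)
    then show ?thesis by (simp add: cinner_self q_def)
  qed
  have "range (blinfun_apply W) = range (blinfun_apply E)"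
  proof (intro equalityI image_subsetI)
    show "W p \<in> range (blinfun_apply E)" for p by (rule range_eqI[of _ _ "W p"]) (simp add: EW)
    show "E p \<in> range (blinfun_apply W)" for p
      by (rule range_eqI[of _ _ "op_adj W p"]) (simp add: WW)
  qed
  then show ?thesis
    using null by (intro that[of A R] A R) (auto simp: graph_quot_range W_def)
qed


section \<open>The affiliated extension\<close>

context vN_normal_hom
begin

text \<open>Null inclusions are transported for matrices, so both operators are placed in an upper
  left corner.\<close>

lemma hom_null_space:
  assumes "A \<in> M" "B \<in> M" "null_space B \<subseteq> null_space A"
  shows "null_space (\<Phi> B) \<subseteq> null_space (\<Phi> A)"
proof
  fix x assume "x \<in> null_space (\<Phi> B)"
  then have "hom_matrix \<Phi> (op_matrix B 0 0 0) (x, 0) = 0"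
    by (simp add: null_space_def hom_zero zero_prod_def)
  then have "hom_matrix \<Phi> (op_matrix A 0 0 0) (x, 0) = 0"
    using assms
    by (intro hom_null_mono[of "op_matrix A 0 0 0" "op_matrix B 0 0 0"])
      (auto simp: dom.zero_mem null_space_def zero_prod_def)
  then show "x \<in> null_space (\<Phi> A)" by (simp add: null_space_def hom_zero zero_prod_def)
qed

text \<open>Matrices over \<open>M\<close> with equal ranges have images with equal ranges, so any
  matrix describing the graph may be used. This gives independence of the representation in
  \<open>aff_ext\<close>, and later the evaluation on closures.\<close>

lemma graph_quot_hom:
  assumes "A \<in> M" "B \<in> M" "null_space B \<subseteq> null_space A"
    and V: "V \<in> matrix_algebra M" "Map.graph (quot A B) = range (blinfun_apply V)"
  shows "Map.graph (quot (\<Phi> A) (\<Phi> B)) = range (blinfun_apply (hom_matrix \<Phi> V))"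
proof -
  have mem: "op_matrix B 0 A 0 \<in> matrix_algebra M" using assms by (simp add: dom.zero_mem)
  have "Map.graph (quot (\<Phi> A) (\<Phi> B)) = range (blinfun_apply (hom_matrix \<Phi> (op_matrix B 0 A 0)))"
    by (simp add: graph_quot_range hom_null_space assms hom_zero)
  also have "\<dots> = range (blinfun_apply (hom_matrix \<Phi> V))"
    using V(2) unfolding graph_quot_range[OF assms(3)]
    by (intro equalityI hom_range_mono mem V(1)) auto
  finally show ?thesis .
qed

lemma aff_ext_quot:
  assumes A: "A \<in> M" and B: "B \<in> M" and null: "null_space B \<subseteq> null_space A"
  shows "aff_ext M \<Phi> (quot A B) = quot (\<Phi> A) (\<Phi> B)"
  unfolding aff_ext_def
proof (rule the_equality)
  fix S
  assume "\<exists>A' B'. A' \<in> M \<and> B' \<in> M \<and> null_space B' \<subseteq> null_space A' \<and>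
    quot A B = quot A' B' \<and> S = quot (\<Phi> A') (\<Phi> B')"
  then obtain A' B' where *: "A' \<in> M" "B' \<in> M" "null_space B' \<subseteq> null_space A'"
    "quot A B = quot A' B'" "S = quot (\<Phi> A') (\<Phi> B')" by blast
  have mem: "op_matrix B 0 A 0 \<in> matrix_algebra M" using A B by (simp add: dom.zero_mem)
  show "S = quot (\<Phi> A) (\<Phi> B)"
    using graph_quot_hom[OF *(1-3) mem] graph_quot_hom[OF A B null mem] graph_quot_range[OF null]
    by (simp add: *(5) flip: *(4) graph_eq_iff)
qed (use assms in blast)

text \<open>Formulated for matrix ranges, so that sums and products are covered at once; applied to
  a closed \<open>T\<close> it also shows that the image is closed.\<close>

lemma aff_ext_closure:
  assumes V: "V \<in> matrix_algebra M" and T: "Map.graph T = range (blinfun_apply V)"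
    and T': "Map.graph T' = range (blinfun_apply (hom_matrix \<Phi> V))"
    and pre: "preclosed_op T"
  shows "preclosed_op T'" "aff_ext M \<Phi> (op_closure T) = op_closure T'"
proof -
  let ?h = "hom_matrix \<Phi>"
  define E where "E = id_blinfun - null_proj (op_adj V)"
  note E = mat.dom.closure_range[OF V, folded E_def]
  have hE: "?h E = id_blinfun - null_proj (op_adj (?h V))"
    unfolding E_def using V
    by (simp add: mat.hom_diff mat.hom_id hom_null_proj mat.hom_adj mat.dom.mem_intros mat.dom.null_proj_mem)
  note E' = mat.cod.closure_range[OF mat.hom_mem[OF V], folded hE]
  have Eb: "E \<in> bounded_ops" and E'b: "?h E \<in> bounded_ops"
    using E(1) E'(1) mat.dom.mem_bounded_ops mat.cod.mem_bounded_ops by auto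
  have graph: "Map.graph (op_closure T) = range (blinfun_apply E)"
    by (simp add: graph_op_closure(1)[OF pre] E(4) T)
  have vert: "y = 0" if "(0, y) \<in> range (blinfun_apply E)" for y
    using no_vertical_if_graph[OF graph_op_closure(2)[OF pre]] that graph by simp
  \<comment> \<open>A vertical vector in the range of the image projection is fixed by
    \<open>\<Phi> e22\<close>. Injectivity of \<open>id_blinfun - e22\<close> is coded as an
    inclusion of its null space in that of the identity, both placed in a lower right
    corner.\<close>
  have vert': "y = 0" if "(0, y) \<in> range (blinfun_apply (?h E))" for y
  proof -
    obtain e11 e12 e21 e22 where Em: "E = op_matrix e11 e12 e21 e22" and e: "e22 \<in> M"
      using E(1) by (rule matrix_algebra_cases)
    have "?h E (0, y) = (0, y)" using that E'(3) by (metis rangeE)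
    then have "\<Phi> e22 y = y" by (simp add: Em)
    then have y: "?h (op_matrix 0 0 0 (id_blinfun - e22)) (0, y) = 0"
      by (simp add: hom_zero hom_diff hom_id dom.id_mem e blinfun.diff_left zero_prod_def)
    have "?h (op_matrix 0 0 0 id_blinfun) (0, y) = 0"
    proof (rule hom_null_mono[OF _ _ _ y])
      fix p :: "'a \<times> 'a"
      assume "op_matrix 0 0 0 (id_blinfun - e22) p = 0"
      then have "ent22 E (snd p) = snd p"
        by (simp add: Em op_matrix_apply' zero_prod_def blinfun.diff_left)
      then have "E (0, snd p) = (0, snd p)" by (rule projection_vertical[OF Eb E(2,3)])
      then have "snd p = 0" by (intro vert range_eqI[of _ _ "(0, snd p)"]) simp
      then show "op_matrix 0 0 0 id_blinfun p = 0" by (simp add: op_matrix_apply' zero_prod_def)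
    qed (simp_all add: dom.zero_mem dom.id_mem dom.diff_mem e)
    then show ?thesis by (simp add: hom_id zero_prod_def)
  qed
  obtain S where S: "Map.graph S = range (blinfun_apply (?h E))"
    using graph_exists_if_no_vertical[OF vert'] .
  have "unbounded_op S" by (rule unbounded_op_if_graph_range[OF E'b S])
  moreover have "unbounded_op T'"
    by (rule unbounded_op_if_graph_range[OF mat.cod.mem_bounded_ops[OF mat.hom_mem[OF V]] T'])
  moreover have S_closure: "Map.graph S = closure (Map.graph T')" by (simp add: S E'(4) T')
  ultimately show pre': "preclosed_op T'" unfolding preclosed_op_def by blast
  \<comment> \<open>\<open>aff_ext\<close> is evaluated on quotients, so the closure is written as
    one.\<close>
  obtain A R where AR: "A \<in> M" "R \<in> M" "null_space R \<subseteq> null_space A"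
    "Map.graph (quot A R) = range (blinfun_apply E)"
    using dom.projection_range_is_quot_graph[OF E(1,2,3) vert] by blast
  then have "op_closure T = quot A R" using graph by (simp flip: graph_eq_iff)
  then have "Map.graph (aff_ext M \<Phi> (op_closure T)) = range (blinfun_apply (?h E))"
    by (simp add: aff_ext_quot graph_quot_hom AR E(1))
  also have "\<dots> = Map.graph (op_closure T')"
    by (simp add: graph_op_closure(1)[OF pre'] S flip: S_closure)
  finally show "aff_ext M \<Phi> (op_closure T) = op_closure T'" by (simp add: graph_eq_iff)
qed

text \<open>Strong sums and products are specified for closed operands only, so the images must be
  closed. A closed operator is its own closure, and the result on closures applies to it.\<close>

lemma closed_aff_ext:
  assumes T: "T \<in> affiliated M" "closed_op T"
  shows "closed_op (aff_ext M \<Phi> T)"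
proof -
  obtain A B where AB: "A \<in> M" "B \<in> M" "null_space B \<subseteq> null_space A" and TAB: "T = quot A B"
    using T(1) unfolding affiliated_def by blast
  have mem: "op_matrix B 0 A 0 \<in> matrix_algebra M" using AB by (simp add: dom.zero_mem)
  have "Map.graph T = range (blinfun_apply (op_matrix B 0 A 0))"
    unfolding TAB by (rule graph_quot_range[OF AB(3)])
  moreover have "Map.graph (aff_ext M \<Phi> T) = range (blinfun_apply (hom_matrix \<Phi> (op_matrix B 0 A 0)))"
    unfolding TAB aff_ext_quot[OF AB] by (rule graph_quot_hom[OF AB mem graph_quot_range[OF AB(3)]])
  ultimately show ?thesis
    using aff_ext_closure[OF mem _ _ closed_imp_preclosed[OF T(2)]] closed_op_closure op_closure_closed[OF T(2)]
    by metis
qed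

lemma aff_ext_sum_graph:
  assumes "T1 \<in> affiliated M" "T2 \<in> affiliated M"
  obtains V where "V \<in> matrix_algebra M" "Map.graph (op_sum T1 T2) = range (blinfun_apply V)"
    "Map.graph (op_sum (aff_ext M \<Phi> T1) (aff_ext M \<Phi> T2)) = range (blinfun_apply (hom_matrix \<Phi> V))"
proof -
  obtain A B where AB: "A \<in> M" "B \<in> M" "null_space B \<subseteq> null_space A" and T1: "T1 = quot A B"
    using assms(1) unfolding affiliated_def by blast
  obtain C D where CD: "C \<in> M" "D \<in> M" "null_space D \<subseteq> null_space C" and T2: "T2 = quot C D"
    using assms(2) unfolding affiliated_def by blast
  let ?X = "op_matrix B (- D) 0 0" and ?U = "op_matrix B 0 A C"
  have X: "?X \<in> matrix_algebra M" and U: "?U \<in> matrix_algebra M"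
    using AB CD by (simp_all add: dom.mem_intros)
  \<comment> \<open>One matrix has to describe both graphs: the null projection of the row is mapped
    to that of the image row.\<close>
  have h: "hom_matrix \<Phi> (?U o\<^sub>L null_proj ?X)
      = op_matrix (\<Phi> B) 0 (\<Phi> A) (\<Phi> C) o\<^sub>L null_proj (op_matrix (\<Phi> B) (- \<Phi> D) 0 0)"
    using AB CD by (simp add: mat.hom_compose[OF U mat.dom.null_proj_mem[OF X]] hom_null_proj[OF X]
        hom_zero hom_uminus)
  have X': "op_matrix (\<Phi> B) (- \<Phi> D) 0 0 \<in> bounded_ops"
    using mat.cod.mem_bounded_ops[OF mat.hom_mem[OF X]] CD by (simp add: hom_zero hom_uminus)
  show ?thesis
  proof (rule that)
    show "?U o\<^sub>L null_proj ?X \<in> matrix_algebra M"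
      by (intro mat.dom.compose_mem mat.dom.null_proj_mem U X)
    show "Map.graph (op_sum T1 T2) = range (blinfun_apply (?U o\<^sub>L null_proj ?X))"
      unfolding T1 T2 by (rule graph_sum_quot[OF AB(3) CD(3) mat.dom.mem_bounded_ops[OF X]])
    show "Map.graph (op_sum (aff_ext M \<Phi> T1) (aff_ext M \<Phi> T2))
        = range (blinfun_apply (hom_matrix \<Phi> (?U o\<^sub>L null_proj ?X)))"
      unfolding T1 T2 h aff_ext_quot[OF AB] aff_ext_quot[OF CD]
      by (rule graph_sum_quot[OF hom_null_space[OF AB] hom_null_space[OF CD] X'])
  qed
qed

lemma aff_ext_prod_graph:
  assumes "T1 \<in> affiliated M" "T2 \<in> affiliated M"
  obtains V where "V \<in> matrix_algebra M" "Map.graph (T1 \<circ>\<^sub>m T2) = range (blinfun_apply V)"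
    "Map.graph (aff_ext M \<Phi> T1 \<circ>\<^sub>m aff_ext M \<Phi> T2) = range (blinfun_apply (hom_matrix \<Phi> V))"
proof -
  obtain A B where AB: "A \<in> M" "B \<in> M" "null_space B \<subseteq> null_space A" and T1: "T1 = quot A B"
    using assms(1) unfolding affiliated_def by blast
  obtain C D where CD: "C \<in> M" "D \<in> M" "null_space D \<subseteq> null_space C" and T2: "T2 = quot C D"
    using assms(2) unfolding affiliated_def by blast
  let ?X = "op_matrix B (- C) 0 0" and ?U = "op_matrix 0 D A 0"
  have X: "?X \<in> matrix_algebra M" and U: "?U \<in> matrix_algebra M"
    using AB CD by (simp_all add: dom.mem_intros)
  have h: "hom_matrix \<Phi> (?U o\<^sub>L null_proj ?X)
      = op_matrix 0 (\<Phi> D) (\<Phi> A) 0 o\<^sub>L null_proj (op_matrix (\<Phi> B) (- \<Phi> C) 0 0)"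
    using AB CD by (simp add: mat.hom_compose[OF U mat.dom.null_proj_mem[OF X]] hom_null_proj[OF X]
        hom_zero hom_uminus)
  have X': "op_matrix (\<Phi> B) (- \<Phi> C) 0 0 \<in> bounded_ops"
    using mat.cod.mem_bounded_ops[OF mat.hom_mem[OF X]] CD by (simp add: hom_zero hom_uminus)
  show ?thesis
  proof (rule that)
    show "?U o\<^sub>L null_proj ?X \<in> matrix_algebra M"
      by (intro mat.dom.compose_mem mat.dom.null_proj_mem U X)
    show "Map.graph (T1 \<circ>\<^sub>m T2) = range (blinfun_apply (?U o\<^sub>L null_proj ?X))"
      unfolding T1 T2 by (rule graph_prod_quot[OF AB(3) CD(3) mat.dom.mem_bounded_ops[OF X]])
    show "Map.graph (aff_ext M \<Phi> T1 \<circ>\<^sub>m aff_ext M \<Phi> T2)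
        = range (blinfun_apply (hom_matrix \<Phi> (?U o\<^sub>L null_proj ?X)))"
      unfolding T1 T2 h aff_ext_quot[OF AB] aff_ext_quot[OF CD]
      by (rule graph_prod_quot[OF hom_null_space[OF AB] hom_null_space[OF CD] X'])
  qed
qed

end

theorem corollary5p6:
  fixes M :: "('a::chilbert_space \<Rightarrow>\<^sub>L 'a) set"
    and N :: "('b::chilbert_space \<Rightarrow>\<^sub>L 'b) set"
    and \<Phi> :: "('a \<Rightarrow>\<^sub>L 'a) \<Rightarrow> ('b \<Rightarrow>\<^sub>L 'b)"
    and T1 T2 :: "'a partial_op"
  assumes "von_neumann_algebra M" and "von_neumann_algebra N"
    and "unital_star_hom M N \<Phi>" and "normal_map M N \<Phi>"
    and "T1 \<in> affiliated M" and "closed_op T1"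
    and "T2 \<in> affiliated M" and "closed_op T2"
  shows "(preclosed_op (op_sum T1 T2) \<longrightarrow>
            preclosed_op (op_sum (aff_ext M \<Phi> T1) (aff_ext M \<Phi> T2)) \<and>
            aff_ext M \<Phi> (strong_sum T1 T2) = strong_sum (aff_ext M \<Phi> T1) (aff_ext M \<Phi> T2)) \<and>
         (preclosed_op (T1 \<circ>\<^sub>m T2) \<longrightarrow>
            preclosed_op (aff_ext M \<Phi> T1 \<circ>\<^sub>m aff_ext M \<Phi> T2) \<and>
            aff_ext M \<Phi> (strong_prod T1 T2) = strong_prod (aff_ext M \<Phi> T1) (aff_ext M \<Phi> T2))"
proof -
  interpret vN_normal_hom M N \<Phi>
    by unfold_locales (fact assms)+
  have closed: "closed_op (aff_ext M \<Phi> T1)" "closed_op (aff_ext M \<Phi> T2)"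
    using closed_aff_ext assms by blast+
  obtain U where U: "U \<in> matrix_algebra M" "Map.graph (op_sum T1 T2) = range (blinfun_apply U)"
    "Map.graph (op_sum (aff_ext M \<Phi> T1) (aff_ext M \<Phi> T2)) = range (blinfun_apply (hom_matrix \<Phi> U))"
    using assms(5,7) by (rule aff_ext_sum_graph)
  obtain V where V: "V \<in> matrix_algebra M" "Map.graph (T1 \<circ>\<^sub>m T2) = range (blinfun_apply V)"
    "Map.graph (aff_ext M \<Phi> T1 \<circ>\<^sub>m aff_ext M \<Phi> T2) = range (blinfun_apply (hom_matrix \<Phi> V))"
    using assms(5,7) by (rule aff_ext_prod_graph)
  show ?thesis
    using aff_ext_closure[OF U] aff_ext_closure[OF V] closed assms(6,8)
    by (simp add: strong_sum_def strong_prod_def)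
qed

end
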